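(* Let $V$ be a vector space of finite dimension $n$ over a field $k$, with basis $v_1,\dots,v_n$. For any integer $m\ge1$, the following equality holds in $\mathbb Z[v_1,\dots,v_n]$: $$\operatorname{ch}(F^m(V))=\sum_{i=0}^{m-1}(-1)^i\operatorname{ch}(S_{(m-i,1^i)}(V)).$$ (Here $\operatorname{ch}(F^m(V))=v_1^m+\cdots+v_n^m$ is the $m$-th power sum polynomial and $\operatorname{ch}(S_{(m-i,1^i)}(V))$ is the Schur polynomial $s_{(m-i,1^i)}(v_1,\dots,v_n)$.)
   Context: Hook Schur modules: let $\kappa_{a,b}:\bigwedge^bV\otimes S_a(V)\to\bigwedge^{b-1}V\otimes S_{a+1}(V)$ be the Koszul map (exterior comultiplication $\bigwedge^bV\to\bigwedge^{b-1}V\otimes V$ followed by symmetric multiplication). For $a\ge1$, $b\ge0$, $S_{(a,1^b)}(V)=\ker\kappa_{a,b}=\operatorname{im}\kappa_{a-1,b+1}\cong\operatorname{coker}\kappa_{a-2,b+2}$. Multidegree and character: a basis element $v_I\otimes v^\alpha$ of $\bigwedge^bV\otimes S_a(V)$, with $v_I=v_{\ell_1}\wedge\cdots\wedge v_{\ell_b}$ and $v^\alpha=v_1^{\alpha_1}\cdots v_n^{\alpha_n}$, has multidegree the monomial $v_{\ell_1}\cdots v_{\ell_b}\cdot v^\alpha\in\mathbb Z[v_1,\dots,v_n]$. This induces a multigrading on $S_{(a,1^b)}(V)$. The character $\operatorname{ch}(E)$ of a multigraded space $E$ is the sum of the multidegrees of the elements of any multigraded basis of $E$. The space $F^m(V)\subset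 S_m(V)$ is the span of $v_1^m,\dots,v_n^m$. *)

theory Defs
  imports Complex_Main "HOL-Library.Poly_Mapping" "HOL-Library.Multiset" "HOL-Library.FuncSet"
begin

section \<open>Free vector spaces\<close>

text \<open>The type \<open>'x \<Rightarrow>\<^sub>0 'k\<close> is the \<open>'k\<close>-vector space with basis \<open>'x\<close>.\<close>

definition fscale :: "'k::field \<Rightarrow> ('x \<Rightarrow>\<^sub>0 'k) \<Rightarrow> ('x \<Rightarrow>\<^sub>0 'k)" where
  "fscale c x = Poly_Mapping.map ((*) c) x"

lemma lookup_fscale [simp]: "Poly_Mapping.lookup (fscale c x) p = c * Poly_Mapping.lookup x p"
  by (simp add: fscale_def Poly_Mapping.map.rep_eq when_def)

global_interpretation free: vector_space fscale
  by unfold_locales (auto intro!: poly_mapping_eqI simp: lookup_add algebra_simps)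

definition lin_ext :: "('x \<Rightarrow> ('y \<Rightarrow>\<^sub>0 'k)) \<Rightarrow> ('x \<Rightarrow>\<^sub>0 'k) \<Rightarrow> ('y \<Rightarrow>\<^sub>0 'k::field)" where
  "lin_ext g x = (\<Sum>p\<in>Poly_Mapping.keys x. fscale (Poly_Mapping.lookup x p) (g p))"


section \<open>The spaces \<open>\<Lambda>\<^sup>b V \<otimes> S\<^sub>a(V)\<close> and the Koszul maps\<close>

text \<open>
  Let \<open>V\<close> be the vector space with carrier \<open>'v\<close> and scalar multiplication \<open>scale\<close>. The space
  \<open>\<Lambda>\<^sup>b V \<otimes> S\<^sub>a(V)\<close> is presented as the quotient \<open>ws_free b a / ws_rel scale b a\<close>: the generator
  \<open>gen [u\<^sub>1,\<dots>,u\<^sub>b] [w\<^sub>1,\<dots>,w\<^sub>a]\<close> stands for \<open>(u\<^sub>1 \<and> \<dots> \<and> u\<^sub>b) \<otimes> (w\<^sub>1 \<cdots> w\<^sub>a)\<close>, and the relations say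
  that it is linear in each of its \<open>b + a\<close> arguments, vanishes if two of the \<open>u\<^sub>i\<close> coincide, and
  does not depend on the order of the \<open>w\<^sub>i\<close>.
\<close>

type_synonym ('v, 'k) ws = "('v list \<times> 'v list) \<Rightarrow>\<^sub>0 'k"

definition gen :: "'v list \<Rightarrow> 'v list \<Rightarrow> ('v, 'k::field) ws" where
  "gen us ws = Poly_Mapping.single (us, ws) 1"

definition ws_free :: "nat \<Rightarrow> nat \<Rightarrow> ('v, 'k::field) ws set" where
  "ws_free b a = free.span {gen us ws | us ws. length us = b \<and> length ws = a}"

definition ws_rel :: "('k::field \<Rightarrow> 'v::ab_group_add \<Rightarrow> 'v) \<Rightarrow> nat \<Rightarrow> nat \<Rightarrow> ('v, 'k) ws set" where
  "ws_rel scale b a = free.span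
    ({gen (us[j := scale c x + y]) ws - fscale c (gen (us[j := x]) ws) - gen (us[j := y]) ws
        | us ws j c x y. length us = b \<and> length ws = a \<and> j < b} \<union>
     {gen us (ws[j := scale c x + y]) - fscale c (gen us (ws[j := x])) - gen us (ws[j := y])
        | us ws j c x y. length us = b \<and> length ws = a \<and> j < a} \<union>
     {gen us ws | us ws. length us = b \<and> length ws = a \<and> \<not> distinct us} \<union>
     {gen us ws - gen us ws' | us ws ws'. length us = b \<and> length ws = a \<and> mset ws' = mset ws})"

text \<open>
  The component \<open>\<Lambda>\<^sup>b V \<rightarrow> \<Lambda>\<^bsup>b-1\<^esup> V \<otimes> V\<close> of the exterior comultiplication: \<open>u\<^sub>1 \<and> \<dots> \<and> u\<^sub>b\<close> is sent to
  the sum over \<open>j\<close> of \<open>(u\<^sub>1 \<and> \<dots> \<and> u\<^sub>b without u\<^sub>j) \<otimes> u\<^sub>j\<close>, with the sign of the permutation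
  that moves \<open>u\<^sub>j\<close> to the last position (\<open>j\<close> counts from \<open>0\<close> below).
\<close>

definition ext_comult :: "'v list \<Rightarrow> ('v list \<times> 'v) \<Rightarrow>\<^sub>0 'k::field" where
  "ext_comult us = (\<Sum>j<length us.
     Poly_Mapping.single (take j us @ drop (Suc j) us, us ! j) ((-1) ^ (length us - Suc j)))"

text \<open>
  The Koszul map on representatives. It maps \<open>ws_free b a\<close> to \<open>ws_free (b - 1) (a + 1)\<close>,
  compatibly with the relations; for \<open>b = 0\<close> it is zero.
\<close>

definition koszul :: "('v, 'k::field) ws \<Rightarrow> ('v, 'k) ws" where
  "koszul = lin_ext (\<lambda>(us, ws). lin_ext (\<lambda>(us', u). gen us' (u # ws)) (ext_comult us))"


section \<open>Hook Schur modules and the span of the powers\<close>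

text \<open>
  A subspace \<open>K / R\<close> of a quotient modulo \<open>R\<close> is encoded by the pair \<open>(K, R)\<close>, where \<open>K \<supseteq> R\<close> is
  its full preimage.
\<close>

type_synonym ('v, 'k) subquot = "('v, 'k) ws set \<times> ('v, 'k) ws set"

text \<open>\<open>S\<^bsub>(a,1\<^sup>b)\<^esub>(V)\<close>, the kernel of the Koszul map on \<open>\<Lambda>\<^sup>b V \<otimes> S\<^sub>a(V)\<close>.\<close>

definition hook_schur ::
  "('k::field \<Rightarrow> 'v::ab_group_add \<Rightarrow> 'v) \<Rightarrow> nat \<Rightarrow> nat \<Rightarrow> ('v, 'k) subquot" where
  "hook_schur scale a b =
     ({x \<in> ws_free b a. koszul x \<in> ws_rel scale (b - 1) (a + 1)}, ws_rel scale b a)"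

text \<open>\<open>F\<^sup>m(V)\<close>, inside \<open>S\<^sub>m(V) = \<Lambda>\<^sup>0 V \<otimes> S\<^sub>m(V)\<close>.\<close>

definition power_span ::
  "('k::field \<Rightarrow> 'v::ab_group_add \<Rightarrow> 'v) \<Rightarrow> (nat \<Rightarrow> 'v) \<Rightarrow> nat \<Rightarrow> nat \<Rightarrow> ('v, 'k) subquot" where
  "power_span scale v n m =
     (free.span ({gen [] (replicate m (v i)) | i. i \<in> {1..n}} \<union> ws_rel scale 0 m), ws_rel scale 0 m)"


section \<open>Multidegrees and characters\<close>

text \<open>
  Monomials in \<open>v\<^sub>1, \<dots>, v\<^sub>n\<close> are given by their exponents, of type \<open>nat \<Rightarrow>\<^sub>0 nat\<close>, and polynomials
  with integer coefficients are the elements of the ring \<open>(nat \<Rightarrow>\<^sub>0 nat) \<Rightarrow>\<^sub>0 int\<close>.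
\<close>

type_synonym monomial = "nat \<Rightarrow>\<^sub>0 nat"
type_synonym int_poly = "monomial \<Rightarrow>\<^sub>0 int"

definition monom :: "monomial \<Rightarrow> int_poly" where
  "monom \<mu> = Poly_Mapping.single \<mu> 1"

text \<open>The basis element \<open>v\<^sub>I \<otimes> v\<^sup>\<alpha>\<close> and its multidegree.\<close>

definition basis_elt :: "(nat \<Rightarrow> 'v) \<Rightarrow> nat \<Rightarrow> nat set \<Rightarrow> monomial \<Rightarrow> ('v, 'k::field) ws" where
  "basis_elt v n I \<alpha> =
     gen (map v (sorted_list_of_set I))
       (concat (map (\<lambda>i. replicate (Poly_Mapping.lookup \<alpha> i) (v i)) [1..<Suc n]))"

definition mdeg :: "nat set \<Rightarrow> monomial \<Rightarrow> monomial" where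
  "mdeg I \<alpha> = (\<Sum>i\<in>I. Poly_Mapping.single i 1) + \<alpha>"

text \<open>
  Elements whose class modulo \<open>R\<close> is homogeneous of multidegree \<open>\<mu>\<close> (or zero). For \<open>R = ws_rel scale b a\<close>,
  only the \<open>v\<^sub>I \<otimes> v\<^sup>\<alpha>\<close> with \<open>card I = b\<close> and \<open>v\<^sup>\<alpha>\<close> of degree \<open>a\<close> matter for elements of \<open>ws_free b a\<close>.
\<close>

definition homogeneous ::
  "(nat \<Rightarrow> 'v) \<Rightarrow> nat \<Rightarrow> ('v, 'k::field) ws set \<Rightarrow> monomial \<Rightarrow> ('v, 'k) ws set" where
  "homogeneous v n R \<mu> = free.span
     ({basis_elt v n I \<alpha> | I \<alpha>. I \<subseteq> {1..n} \<and> Poly_Mapping.keys \<alpha> \<subseteq> {1..n} \<and> mdeg I \<alpha> = \<mu>} \<union> R)"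

text \<open>
  \<open>B\<close> is a set of representatives of a basis of \<open>K / R\<close> consisting of homogeneous elements, the
  class of \<open>x \<in> B\<close> having multidegree \<open>d x\<close>. Linear independence modulo \<open>R\<close> also forces
  different elements of \<open>B\<close> to have different classes.
\<close>

definition multigraded_basis ::
  "(nat \<Rightarrow> 'v) \<Rightarrow> nat \<Rightarrow> ('v, 'k::field) subquot \<Rightarrow> ('v, 'k) ws set \<Rightarrow> (('v, 'k) ws \<Rightarrow> monomial) \<Rightarrow> bool"
where
  "multigraded_basis v n E B d \<longleftrightarrow> (case E of (K, R) \<Rightarrow>
     B \<subseteq> K \<and> free.span (B \<union> R) = K \<and>
     (\<forall>F c. finite F \<and> F \<subseteq> B \<and> (\<Sum>x\<in>F. fscale (c x) x) \<in> R \<longrightarrow> (\<forall>x\<in>F. c x = 0)) \<and>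
     (\<forall>x\<in>B. x \<in> homogeneous v n R (d x)))"

definition ch :: "(nat \<Rightarrow> 'v) \<Rightarrow> nat \<Rightarrow> ('v, 'k::field) subquot \<Rightarrow> int_poly" where
  "ch v n E = (THE p. \<exists>B d. finite B \<and> multigraded_basis v n E B d \<and> p = (\<Sum>x\<in>B. monom (d x)))"


section \<open>Schur polynomials\<close>

text \<open>A partition is a weakly decreasing list; rows and columns of diagrams count from \<open>0\<close>.\<close>

definition cells :: "nat list \<Rightarrow> (nat \<times> nat) set" where
  "cells sh = {(i, j). i < length sh \<and> j < sh ! i}"

definition ssyt :: "nat \<Rightarrow> nat list \<Rightarrow> (nat \<times> nat \<Rightarrow> nat) set" where
  "ssyt n sh = {T \<in> cells sh \<rightarrow>\<^sub>E {1..n}.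
     (\<forall>i j j'. j < j' \<and> (i, j') \<in> cells sh \<longrightarrow> T (i, j) \<le> T (i, j')) \<and>
     (\<forall>i i' j. i < i' \<and> (i', j) \<in> cells sh \<longrightarrow> T (i, j) < T (i', j))}"

definition schur_poly :: "nat \<Rightarrow> nat list \<Rightarrow> int_poly" where
  "schur_poly n sh = (\<Sum>T\<in>ssyt n sh. monom (\<Sum>p\<in>cells sh. Poly_Mapping.single (T p) 1))"

end

theory Submission
  imports Defs "Jordan_Normal_Form.Determinant"
begin

text \<open>
  Fix a multidegree \<open>\<mu> \<noteq> 0\<close>. In this degree the spaces \<open>\<Lambda>\<^sup>b V \<otimes> S\<^sub>a(V)\<close> have the basis
  \<open>v\<^sub>I \<otimes> v\<^bsup>\<mu> - I\<^esup>\<close>, where \<open>I\<close> runs over the sets of size \<open>b\<close> of variables occurring in \<open>\<mu>\<close>, and the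
  Koszul map removes one element of \<open>I\<close> at a time, with a sign. So the Koszul complex is the augmented
  chain complex of the full simplex on the support of \<open>\<mu>\<close>. Let \<open>c\<close> be the least variable in \<open>\<mu>\<close>. The
  simplex is a cone with apex \<open>c\<close>; therefore the boundaries of the faces \<open>J \<union> {c}\<close>, with \<open>J\<close> not
  containing \<open>c\<close>, form a basis of the cycles. This holds over every field. The kernel of the Koszul
  map thus has a basis indexed by triples \<open>(c, J, \<gamma>)\<close> with \<open>c < j\<close> for \<open>j \<in> J\<close> and \<open>c \<le> j\<close> for \<open>j\<close>
  in the support of \<open>\<gamma>\<close> (lemma \<open>ch_hook_schur\<close>).

  These triples are the semistandard tableaux of hook shape: \<open>c\<close> is the corner, \<open>J\<close> the set of entries
  below it, and \<open>\<gamma>\<close> counts the entries to its right (lemma \<open>schur_poly_hook\<close>). On the other hand, for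
  fixed \<open>\<mu>\<close> of degree \<open>m\<close> the set \<open>J\<close> is an arbitrary subset of the support of \<open>\<mu>\<close> without \<open>c\<close>, so the
  coefficient of \<open>\<mu>\<close> in the alternating sum is the sum of \<open>(-1)\<^bsup>|J|\<^esup>\<close> over these subsets. It vanishes
  unless \<open>c\<close> is the only variable of \<open>\<mu>\<close>, and is \<open>1\<close> in that case, which leaves the power sum
  (lemma \<open>alternating_sum_hooks\<close>).

  All spaces here are given by generators and relations, so one has to show that the \<open>v\<^sub>I \<otimes> v\<^sup>\<alpha>\<close> are a
  basis modulo the relations. They span by multilinearity (lemma \<open>span_basis_elt\<close>). For independence,
  \<open>wedge_coord\<close> sends \<open>(u\<^sub>1 \<and> \<dots> \<and> u\<^sub>b) \<otimes> (w\<^sub>1 \<cdots> w\<^sub>a)\<close> to a minor of the coordinates of the \<open>u\<^sub>j\<close> times the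
  polynomial \<open>w\<^sub>1 \<cdots> w\<^sub>a\<close>; this kills the relations. By Laplace expansion the Koszul map becomes
  multiplication by variables in these coordinates (lemma \<open>wedge_coord_koszul\<close>), and everything needed
  about it (compatibility with the relations, square zero, the description of its kernel) is read off
  from this one formula. Finally, the character does not depend on the choice of a multigraded basis by
  the exchange lemma, applied in each multidegree (lemma \<open>ch_eqI\<close>).
\<close>

hide_const (open) Polynomial.monom

section \<open>Linear extension and the Koszul map\<close>

lemma lin_ext_superset:
  assumes "finite A" "Poly_Mapping.keys x \<subseteq> A"
  shows "lin_ext g x = (\<Sum>p\<in>A. fscale (Poly_Mapping.lookup x p) (g p))"
  unfolding lin_ext_def using assms
  by (intro sum.mono_neutral_left) (auto simp: in_keys_iff)

lemma lin_ext_add: "lin_ext g (x + y) = lin_ext g x + lin_ext g y"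
proof -
  let ?A = "Poly_Mapping.keys x \<union> Poly_Mapping.keys y"
  have "Poly_Mapping.keys (x + y) \<subseteq> ?A" by (rule Poly_Mapping.keys_add)
  then show ?thesis
    by (simp add: lin_ext_superset[of ?A] lookup_add free.scale_left_distrib sum.distrib)
qed

lemma lin_ext_fscale: "lin_ext g (fscale c x) = fscale c (lin_ext g x)"
proof -
  have "Poly_Mapping.keys (fscale c x) \<subseteq> Poly_Mapping.keys x"
    by (auto simp: in_keys_iff)
  then show ?thesis
    by (simp add: lin_ext_superset[of "Poly_Mapping.keys x"] free.scale_sum_right)
qed

lemma lin_ext_zero [simp]: "lin_ext g 0 = 0"
  by (simp add: lin_ext_def)

lemma lin_ext_minus: "lin_ext g (x - y) = lin_ext g x - lin_ext g y"
  using lin_ext_add[of g "x - y" y] by simp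

lemma lin_ext_sum: "lin_ext g (\<Sum>i\<in>A. f i) = (\<Sum>i\<in>A. lin_ext g (f i))"
  by (induction A rule: infinite_finite_induct) (auto simp: lin_ext_add)

lemma lin_ext_single: "lin_ext g (Poly_Mapping.single p c) = fscale c (g p)"
  by (simp add: lin_ext_superset[of "{p}"])

lemma ws_induct [case_names zero add gen]:
  fixes x :: "('v, 'k::field) ws"
  assumes "P 0" "\<And>x y. P x \<Longrightarrow> P y \<Longrightarrow> P (x + y)" "\<And>c us ws. P (fscale c (gen us ws))"
  shows "P x"
proof -
  have eq: "x = (\<Sum>p\<in>Poly_Mapping.keys x. fscale (Poly_Mapping.lookup x p) (gen (fst p) (snd p)))"
    by (rule poly_mapping_eqI) (simp add: gen_def lookup_sum lookup_single when_def in_keys_iff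
      if_distrib[of "(*) _"] cong: if_cong)
  have "P (\<Sum>p\<in>A. fscale (c p) (gen (fst p) (snd p)))" for A c
    by (induction A rule: infinite_finite_induct) (simp_all add: assms)
  then show ?thesis by (subst eq)
qed

lemma koszul_gen:
  "koszul (gen us ws :: ('v, 'k::field) ws)
     = (\<Sum>j<length us. fscale ((-1) ^ (length us - Suc j))
          (gen (take j us @ drop (Suc j) us) (us ! j # ws)))"
  by (simp add: koszul_def gen_def lin_ext_single ext_comult_def lin_ext_sum)

lemma koszul_add: "koszul (x + y) = koszul x + koszul y"
  and koszul_fscale: "koszul (fscale c x) = fscale c (koszul x)"
  by (simp_all add: koszul_def lin_ext_add lin_ext_fscale)

lemma koszul_zero [simp]: "koszul 0 = 0"
  by (simp add: koszul_def)

lemma fscale_mult_left: "fscale c (x :: 'a::comm_monoid_add \<Rightarrow>\<^sub>0 'k::field) * y = fscale c (x * y)"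
  by (simp add: fscale_def mult_map_scale_conv_mult mult.assoc)

lemma fscale_mult_right: "x * fscale c (y :: 'a::comm_monoid_add \<Rightarrow>\<^sub>0 'k::field) = fscale c (x * y)"
  by (simp add: fscale_def mult_map_scale_conv_mult mult.left_commute)

lemma fscale_single: "fscale c (Poly_Mapping.single p d) = Poly_Mapping.single p (c * d)"
  by (rule poly_mapping_eqI) (simp add: lookup_single when_def)

definition var :: "nat \<Rightarrow> monomial \<Rightarrow>\<^sub>0 'k::field" where
  "var i = Poly_Mapping.single (Poly_Mapping.single i 1) 1"

section \<open>Monomials, words and multidegrees\<close>

definition weight :: "nat list \<Rightarrow> monomial" where
  "weight js = (\<Sum>j\<leftarrow>js. Poly_Mapping.single j 1)"

lemma lookup_weight: "Poly_Mapping.lookup (weight js) i = count (mset js) i"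
  by (induction js) (auto simp: weight_def lookup_add lookup_single when_def)

lemma keys_weight: "Poly_Mapping.keys (weight js) = set js"
  by (auto simp: in_keys_iff lookup_weight)

lemma weight_eq_iff: "weight js = weight js' \<longleftrightarrow> mset js = mset js'"
  by (metis lookup_weight multiset_eqI poly_mapping_eqI)

text \<open>The spelling of \<open>v\<^sup>\<alpha>\<close> that \<open>basis_elt\<close> uses, on the level of indices.\<close>

definition word :: "nat \<Rightarrow> monomial \<Rightarrow> nat list" where
  "word n \<alpha> = concat (map (\<lambda>i. replicate (Poly_Mapping.lookup \<alpha> i) i) [1..<Suc n])"

lemma basis_elt_word: "basis_elt v n I \<alpha> = gen (map v (sorted_list_of_set I)) (map v (word n \<alpha>))"
  by (simp add: basis_elt_def word_def map_concat comp_def)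

lemma word_Suc: "word (Suc n) \<alpha> = word n \<alpha> @ replicate (Poly_Mapping.lookup \<alpha> (Suc n)) (Suc n)"
  by (simp add: word_def)

lemma count_word: "count (mset (word n \<alpha>)) i = (if i \<in> {1..n} then Poly_Mapping.lookup \<alpha> i else 0)"
  by (induction n) (auto simp: word_Suc word_def)

lemma set_word: "set (word n \<alpha>) = Poly_Mapping.keys \<alpha> \<inter> {1..n}"
  using count_word[of n \<alpha>]
  by (auto simp: in_keys_iff simp flip: set_mset_mset count_greater_zero_iff split: if_splits)

lemma sorted_word: "sorted (word n \<alpha>)"
  by (induction n) (auto simp: word_Suc sorted_append set_word word_def)

lemma weight_word: "Poly_Mapping.keys \<alpha> \<subseteq> {1..n} \<Longrightarrow> weight (word n \<alpha>) = \<alpha>"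
  by (rule poly_mapping_eqI) (auto simp: lookup_weight count_word in_keys_iff)

text \<open>The exponents of the monomials of degree \<open>a\<close> in the variables with index in \<open>A\<close>.\<close>

definition exps :: "nat set \<Rightarrow> nat \<Rightarrow> monomial set" where
  "exps A a = {\<alpha>. Poly_Mapping.keys \<alpha> \<subseteq> A \<and> (\<Sum>i\<in>A. Poly_Mapping.lookup \<alpha> i) = a}"

lemma length_word: "length (word n \<alpha>) = (\<Sum>i = 1..n. Poly_Mapping.lookup \<alpha> i)"
  by (induction n) (auto simp: word_Suc word_def)

lemma exps_subset_iff:
  assumes "A \<subseteq> B" "finite B"
  shows "\<alpha> \<in> exps A a \<longleftrightarrow> \<alpha> \<in> exps B a \<and> Poly_Mapping.keys \<alpha> \<subseteq> A"
proof -
  have "sum (Poly_Mapping.lookup \<alpha>) A = sum (Poly_Mapping.lookup \<alpha>) B"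
    if "Poly_Mapping.keys \<alpha> \<subseteq> A"
    using assms that by (intro sum.mono_neutral_left) (auto simp: in_keys_iff)
  then show ?thesis using assms by (auto simp: exps_def)
qed

lemma lookup_mdeg:
  "finite I \<Longrightarrow> Poly_Mapping.lookup (mdeg I \<gamma>) i = (if i \<in> I then 1 else 0) + Poly_Mapping.lookup \<gamma> i"
  by (simp add: mdeg_def lookup_add lookup_sum lookup_single when_def)

lemma keys_mdeg: "finite I \<Longrightarrow> Poly_Mapping.keys (mdeg I \<gamma>) = I \<union> Poly_Mapping.keys \<gamma>"
  by (auto simp: in_keys_iff lookup_mdeg split: if_splits)

lemma mdeg_in_exps_iff:
  assumes "finite A" "I \<subseteq> A"
  shows "mdeg I \<gamma> \<in> exps A (card I + k) \<longleftrightarrow> \<gamma> \<in> exps A k"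
proof -
  have fin: "finite I" using assms by (rule finite_subset[rotated])
  have "(\<Sum>i\<in>A. if i \<in> I then 1 else 0) = card I"
    using assms by (simp add: sum.If_cases Int_absorb1)
  then show ?thesis
    using assms by (simp add: exps_def keys_mdeg[OF fin] lookup_mdeg[OF fin] sum.distrib)
qed

lemma mdeg_complement:
  assumes "finite I" "I \<subseteq> Poly_Mapping.keys \<mu>"
  shows "mdeg I (\<mu> - mdeg I 0) = \<mu>"
  using assms by (intro poly_mapping_eqI) (auto simp: lookup_mdeg lookup_minus in_keys_iff)

lemma mdeg_eq_iff: "mdeg I \<gamma> = mdeg I \<gamma>' \<longleftrightarrow> \<gamma> = \<gamma>'"
  by (simp add: mdeg_def)

lemma weight_exps: "set js \<subseteq> A \<Longrightarrow> finite A \<Longrightarrow> weight js \<in> exps A (length js)"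
proof -
  assume "set js \<subseteq> A" "finite A"
  then have "size (mset js) = sum (count (mset js)) A"
    unfolding size_multiset_overloaded_eq
    by (intro sum.mono_neutral_left) (auto simp: not_in_iff)
  with \<open>set js \<subseteq> A\<close> show ?thesis by (simp add: exps_def keys_weight lookup_weight)
qed

lemma finite_exps:
  assumes "finite A"
  shows "finite (exps A a)"
proof (rule finite_imageD)
  let ?f = "\<lambda>\<alpha>::monomial. \<lambda>i\<in>A. Poly_Mapping.lookup \<alpha> i"
  have "?f ` exps A a \<subseteq> A \<rightarrow>\<^sub>E {..a}"
    using assms by (auto simp: exps_def intro!: member_le_sum)
  then show "finite (?f ` exps A a)"
    by (rule finite_subset) (simp add: assms finite_PiE)
  show "inj_on ?f (exps A a)"
  proof (rule inj_onI, rule poly_mapping_eqI)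
    fix \<alpha> \<beta> :: monomial and i
    assume "\<alpha> \<in> exps A a" "\<beta> \<in> exps A a" "?f \<alpha> = ?f \<beta>"
    show "Poly_Mapping.lookup \<alpha> i = Poly_Mapping.lookup \<beta> i"
    proof (cases "i \<in> A")
      case True
      then show ?thesis using fun_cong[OF \<open>?f \<alpha> = ?f \<beta>\<close>, of i] by simp
    next
      case False
      then have "i \<notin> Poly_Mapping.keys \<alpha>" "i \<notin> Poly_Mapping.keys \<beta>"
        using \<open>\<alpha> \<in> exps A a\<close> \<open>\<beta> \<in> exps A a\<close> by (auto simp: exps_def)
      then show ?thesis by (simp add: in_keys_iff)
    qed
  qed
qed

lemma word_weight:
  assumes "set js \<subseteq> {1..n}"
  shows "word n (weight js) = sort js"
proof -
  have "mset (word n (weight js)) = mset js"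
    using assms by (simp add: weight_word keys_weight flip: weight_eq_iff)
  then show ?thesis using sorted_word[of n "weight js"] by (metis properties_for_sort sorted_sort_id mset_sort)
qed

lemma weight_replicate: "weight (replicate m i) = Poly_Mapping.single i m"
  by (rule poly_mapping_eqI) (auto simp: lookup_weight lookup_single when_def)

lemma lookup_var_mult: "Poly_Mapping.lookup (var i * q) (Poly_Mapping.single i 1 + \<beta>) = Poly_Mapping.lookup q \<beta>"
  by (simp add: var_def lookup_mult lookup_single when_mult)

lemma lookup_var_mult_eq_0:
  assumes "Poly_Mapping.lookup \<beta> i = 0"
  shows "Poly_Mapping.lookup (var i * q) \<beta> = 0"
proof -
  have "\<beta> \<noteq> Poly_Mapping.single i 1 + \<gamma>" for \<gamma>
    using assms by (auto simp: lookup_add)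
  then show ?thesis by (simp add: var_def lookup_mult lookup_single when_mult)
qed

lemma split_off_single:
  assumes "Poly_Mapping.lookup \<beta> i > 0"
  obtains \<gamma> :: monomial where "\<beta> = Poly_Mapping.single i 1 + \<gamma>"
proof
  show "\<beta> = Poly_Mapping.single i 1 + (\<beta> - Poly_Mapping.single i 1)"
    using assms by (intro poly_mapping_eqI) (auto simp: lookup_add lookup_minus lookup_single when_def)
qed

lemma exps_single_add_iff:
  assumes "finite A"
  shows "Poly_Mapping.single i 1 + \<gamma> \<in> exps A (Suc a) \<longleftrightarrow> i \<in> A \<and> \<gamma> \<in> exps A a"
proof -
  have keys: "Poly_Mapping.keys (Poly_Mapping.single i 1 + \<gamma>) = insert i (Poly_Mapping.keys \<gamma>)"
    by (auto simp: in_keys_iff lookup_add lookup_single when_def split: if_splits)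
  show ?thesis
    using assms by (auto simp: exps_def keys[unfolded One_nat_def] lookup_add sum.distrib lookup_single when_def)
qed

lemma mdeg_insert:
  "finite I \<Longrightarrow> i \<notin> I \<Longrightarrow> mdeg (insert i I) \<gamma> = mdeg I (Poly_Mapping.single i 1 + \<gamma>)"
  by (simp add: mdeg_def ac_simps)

section \<open>Relations and generators\<close>

lemma subspace_ws_rel: "free.subspace (ws_rel scale b a)"
  by (simp add: ws_rel_def)

lemma subspace_ws_free: "free.subspace (ws_free b a)"
  by (simp add: ws_free_def)

lemma gen_in_ws_free: "length us = b \<Longrightarrow> length ws = a \<Longrightarrow> gen us ws \<in> ws_free b a"
  unfolding ws_free_def by (rule free.span_base) blast

lemma ws_rel_lin_left:
  assumes "length us = b" "length ws = a" "j < b"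
  shows "gen (us[j := scale c x + y]) ws - fscale c (gen (us[j := x]) ws) - gen (us[j := y]) ws
    \<in> ws_rel scale b a"
  unfolding ws_rel_def using assms by (intro free.span_base) blast

lemma ws_rel_lin_right:
  assumes "length us = b" "length ws = a" "j < a"
  shows "gen us (ws[j := scale c x + y]) - fscale c (gen us (ws[j := x])) - gen us (ws[j := y])
    \<in> ws_rel scale b a"
  unfolding ws_rel_def using assms by (intro free.span_base) blast

lemma ws_rel_alternating:
  assumes "length us = b" "length ws = a" "\<not> distinct us"
  shows "gen us ws \<in> ws_rel scale b a"
  unfolding ws_rel_def using assms by (intro free.span_base) blast

lemma ws_rel_symmetric:
  assumes "length us = b" "length ws = a" "mset ws' = mset ws"
  shows "gen us ws - gen us ws' \<in> ws_rel scale b a"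
  unfolding ws_rel_def using assms by (intro free.span_base) blast

lemma ws_rel_subset_ws_free: "ws_rel scale b a \<subseteq> ws_free b a"
  unfolding ws_rel_def
proof (rule free.span_minimal[OF _ subspace_ws_free], safe)
qed (auto intro!: free.subspace_diff[OF subspace_ws_free] free.subspace_scale[OF subspace_ws_free]
    gen_in_ws_free dest: mset_eq_length)

lemma koszul_ws_free:
  assumes "x \<in> ws_free (Suc b) a"
  shows "koszul x \<in> ws_free b (Suc a)"
  using assms unfolding ws_free_def[of "Suc b"]
proof (induction rule: free.span_induct_alt)
  case base
  then show ?case by (simp add: free.subspace_0[OF subspace_ws_free])
next
  case (step c x y)
  from step(1) have "koszul x \<in> ws_free b (Suc a)"
    by (auto simp: koszul_gen simp del: sum.lessThan_Suc intro!: free.subspace_sum[OF subspace_ws_free]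
        free.subspace_scale[OF subspace_ws_free] gen_in_ws_free)
  then show ?case
    using step(2) by (simp add: koszul_add koszul_fscale free.subspace_add[OF subspace_ws_free]
        free.subspace_scale[OF subspace_ws_free])
qed

lemma koszul_ws_free_0: "x \<in> ws_free 0 a \<Longrightarrow> koszul x = 0"
  unfolding ws_free_def
  by (induction rule: free.span_induct_alt) (auto simp: koszul_add koszul_fscale koszul_gen)

section \<open>Coordinates with values in polynomials\<close>

locale based_space = vector_space scale
  for scale :: "'k::field \<Rightarrow> 'v::ab_group_add \<Rightarrow> 'v" +
  fixes v :: "nat \<Rightarrow> 'v" and n :: nat
  assumes inj_v: "inj_on v {1..n}"
    and indep_v: "\<not> dependent (v ` {1..n})"
    and span_v: "span (v ` {1..n}) = UNIV"
begin

definition coord :: "nat \<Rightarrow> 'v \<Rightarrow> 'k" where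
  "coord i u = representation (v ` {1..n}) u (v i)"

lemma coord_lin: "coord i (scale c x + y) = c * coord i x + coord i y"
  unfolding coord_def
  by (simp add: representation_add representation_scale indep_v span_v del: One_nat_def)

lemma coord_v: "i \<in> {1..n} \<Longrightarrow> j \<in> {1..n} \<Longrightarrow> coord i (v j) = (if i = j then 1 else 0)"
  unfolding coord_def using inj_on_eq_iff[OF inj_v]
  by (subst representation_basis[OF indep_v]) simp_all

definition linform :: "'v \<Rightarrow> monomial \<Rightarrow>\<^sub>0 'k" where
  "linform u = (\<Sum>i = 1..n. fscale (coord i u) (var i))"

lemma linform_lin: "linform (scale c x + y) = fscale c (linform x) + linform y"
  by (simp add: linform_def coord_lin free.scale_left_distrib sum.distrib free.scale_sum_right)

lemma linform_times: "linform u * q = (\<Sum>i = 1..n. fscale (coord i u) (var i * q))"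
  by (simp add: linform_def sum_distrib_right fscale_mult_left)

lemma linform_v: "i \<in> {1..n} \<Longrightarrow> linform (v i) = var i"
proof -
  assume "i \<in> {1..n}"
  then have "linform (v i) = (\<Sum>j = 1..n. if j = i then var i else 0)"
    unfolding linform_def by (intro sum.cong) (auto simp: coord_v)
  then show ?thesis using \<open>i \<in> {1..n}\<close> by simp
qed

definition symprod :: "'v list \<Rightarrow> monomial \<Rightarrow>\<^sub>0 'k" where
  "symprod ws = prod_list (map linform ws)"

lemma symprod_Cons: "symprod (w # ws) = linform w * symprod ws"
  by (simp add: symprod_def)

lemma symprod_cong_mset: "mset ws = mset ws' \<Longrightarrow> symprod ws = symprod ws'"
  unfolding symprod_def by (metis mset_map prod_mset_prod_list)

lemma symprod_lin:
  assumes "j < length ws"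
  shows "symprod (ws[j := scale c x + y])
           = fscale c (symprod (ws[j := x])) + symprod (ws[j := y])"
  using assms
  by (simp add: symprod_def upd_conv_take_nth_drop linform_lin fscale_mult_left fscale_mult_right
      distrib_left distrib_right)

definition minor_mat :: "nat list \<Rightarrow> 'v list \<Rightarrow> 'k mat" where
  "minor_mat il us = mat (length il) (length il) (\<lambda>(r, c). coord (il ! r) (us ! c))"

text \<open>The determinant with rows indexed by \<open>il\<close> and columns by \<open>us\<close>. The value \<open>0\<close> for lists of different
  lengths lets the same functional be used on all \<open>\<Lambda>\<^sup>b V \<otimes> S\<^sub>a(V)\<close> at once.\<close>

definition minor :: "nat list \<Rightarrow> 'v list \<Rightarrow> 'k" where
  "minor il us = (if length us = length il then det (minor_mat il us) else 0)"

lemma minor_mat_carrier [simp]: "minor_mat il us \<in> carrier_mat (length il) (length il)"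
  by (simp add: minor_mat_def)

text \<open>In the Leibniz formula, the vector in slot \<open>j\<close> contributes exactly one factor to each product.\<close>

lemma minor_lin:
  assumes "j < length us"
  shows "minor il (us[j := scale c x + y])
           = c * minor il (us[j := x]) + minor il (us[j := y])"
proof (cases "length us = length il")
  case True
  define b where "b = length il"
  have b: "length us = b" "length il = b" "j < b" using True assms by (auto simp: b_def)
  let ?rest = "\<lambda>p. \<Prod>c\<in>{..<b} - {j}. coord (il ! p c) (us ! c)"
  have det: "minor il (us[j := z]) =
      (\<Sum>p | p permutes {0..<b}. signof p * (coord (il ! p j) z * ?rest p))" for z
  proof -
    have "minor il (us[j := z]) =
        (\<Sum>p | p permutes {0..<b}. signof p * (\<Prod>c<b. minor_mat il (us[j := z]) $$ (p c, c)))"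
      using b det_col[OF minor_mat_carrier, of il "us[j := z]"] by (simp add: minor_def)
    also have "\<dots> = (\<Sum>p | p permutes {0..<b}. signof p * (coord (il ! p j) z * ?rest p))"
    proof (intro sum.cong refl arg_cong2[of _ _ _ _ "(*)"])
      fix p assume "p \<in> {p. p permutes {0..<b}}"
      then have p: "p c < b" if "c < b" for c
        using that permutes_in_image[of p "{0..<b}" c] by simp
      have "(\<Prod>c<b. minor_mat il (us[j := z]) $$ (p c, c))
          = (\<Prod>c<b. coord (il ! p c) (us[j := z] ! c))"
        by (intro prod.cong) (auto simp: minor_mat_def b p)
      also have "\<dots> = coord (il ! p j) z * (\<Prod>c\<in>{..<b} - {j}. coord (il ! p c) (us[j := z] ! c))"
        using b by (subst prod.remove[of _ j]) auto
      also have "(\<Prod>c\<in>{..<b} - {j}. coord (il ! p c) (us[j := z] ! c)) = ?rest p"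
        by (intro prod.cong) auto
      finally show "(\<Prod>c<b. minor_mat il (us[j := z]) $$ (p c, c)) = coord (il ! p j) z * ?rest p" .
    qed
    finally show ?thesis .
  qed
  show ?thesis unfolding det coord_lin
    by (simp add: sum_distrib_left sum.distrib[symmetric] algebra_simps)
qed (simp add: minor_def)

lemma minor_not_distinct:
  assumes "\<not> distinct us"
  shows "minor il us = 0"
proof (cases "length us = length il")
  case True
  then obtain i j where "i < length il" "j < length il" "i \<noteq> j" "us ! i = us ! j"
    using assms by (auto simp: distinct_conv_nth)
  then have "det (minor_mat il us) = 0"
    by (intro det_identical_columns[OF minor_mat_carrier, of i j]) (auto simp: minor_mat_def)
  then show ?thesis by (simp add: minor_def)
qed (simp add: minor_def)

lemma minor_rows_not_distinct:
  assumes "\<not> distinct il"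
  shows "minor il us = 0"
proof -
  obtain i j where "i < length il" "j < length il" "i \<noteq> j" "il ! i = il ! j"
    using assms by (auto simp: distinct_conv_nth)
  then have "det (minor_mat il us) = 0"
    by (intro det_identical_rows[OF minor_mat_carrier, of i j]) (auto simp: minor_mat_def)
  then show ?thesis by (simp add: minor_def)
qed

lemma minor_swap: "minor (pre @ i # i' # suf) us = - minor (pre @ i' # i # suf) us"
proof (cases "length us = length (pre @ i # i' # suf)")
  case True
  let ?k = "length pre" and ?A = "minor_mat (pre @ i' # i # suf) us"
  have "minor_mat (pre @ i # i' # suf) us = swaprows ?k (Suc ?k) ?A"
    by (rule eq_matI) (auto simp: minor_mat_def nth_append nth_Cons split: nat.split)
  moreover have "det (swaprows ?k (Suc ?k) ?A) = - det ?A"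
    by (rule det_swaprows[OF _ _ _ minor_mat_carrier]) auto
  ultimately show ?thesis using True by (simp add: minor_def)
qed (simp add: minor_def)

text \<open>Laplace expansion along the last row. Its signs agree with those of the exterior comultiplication,
  which moves \<open>u\<^sub>j\<close> to the last position.\<close>

lemma minor_snoc:
  "minor (il @ [i]) us = (\<Sum>j<length us. (-1) ^ (length us - Suc j) *
      coord i (us ! j) * minor il (take j us @ drop (Suc j) us))"
proof (cases "length us = Suc (length il)")
  case True
  let ?b = "length il" and ?A = "minor_mat (il @ [i]) us"
  have "det ?A = (\<Sum>j<Suc ?b. ?A $$ (?b, j) * cofactor ?A ?b j)"
    using laplace_expansion_row[of ?A "Suc ?b" ?b] minor_mat_carrier[of "il @ [i]" us] by simp
  also have "\<dots> = (\<Sum>j<length us. (-1) ^ (length us - Suc j) *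
      coord i (us ! j) * minor il (take j us @ drop (Suc j) us))"
  proof (intro sum.cong)
    fix j assume "j \<in> {..<length us}"
    then have j: "j < Suc ?b" using True by simp
    have "mat_delete ?A ?b j = minor_mat il (take j us @ drop (Suc j) us)"
      using j True by (intro eq_matI) (auto simp: minor_mat_def mat_delete_def nth_append)
    moreover have "(-1::'k) ^ (?b + j) = (-1) ^ (length us - Suc j)"
      using j True by (auto simp: minus_one_power_iff)
    ultimately show "?A $$ (?b, j) * cofactor ?A ?b j = (-1) ^ (length us - Suc j) *
      coord i (us ! j) * minor il (take j us @ drop (Suc j) us)"
      using j True by (simp add: cofactor_def minor_def minor_mat_def)
  qed (simp add: True)
  finally show ?thesis using True by (simp add: minor_def)
next
  case False
  then have "minor il (take j us @ drop (Suc j) us) = 0" if "j < length us" for j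
    using that by (auto simp: minor_def)
  then show ?thesis using False by (simp add: minor_def)
qed

text \<open>The symmetric factor is kept as a polynomial instead of being split into coefficients, because then
  the Koszul map becomes multiplication by variables.\<close>

definition wedge_coord :: "nat list \<Rightarrow> ('v, 'k) ws \<Rightarrow> monomial \<Rightarrow>\<^sub>0 'k" where
  "wedge_coord il = lin_ext (\<lambda>(us, ws). fscale (minor il us) (symprod ws))"

lemma wedge_coord_add: "wedge_coord il (x + y) = wedge_coord il x + wedge_coord il y"
  and wedge_coord_minus: "wedge_coord il (x - y) = wedge_coord il x - wedge_coord il y"
  and wedge_coord_fscale: "wedge_coord il (fscale c x) = fscale c (wedge_coord il x)"
  and wedge_coord_sum: "wedge_coord il (\<Sum>a\<in>A. f a) = (\<Sum>a\<in>A. wedge_coord il (f a))"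
  by (simp_all add: wedge_coord_def lin_ext_add lin_ext_minus lin_ext_fscale lin_ext_sum)

lemma wedge_coord_zero [simp]: "wedge_coord il 0 = 0"
  by (simp add: wedge_coord_def)

lemma wedge_coord_gen: "wedge_coord il (gen us ws) = fscale (minor il us) (symprod ws)"
  by (simp add: wedge_coord_def gen_def lin_ext_single)

text \<open>Minors are multilinear and alternating in the vectors, and products of linear forms are multilinear
  and symmetric; these are the four kinds of relations.\<close>

lemma wedge_coord_ws_rel:
  assumes "x \<in> ws_rel scale b a"
  shows "wedge_coord il x = 0"
  using assms unfolding ws_rel_def
proof (induction rule: free.span_induct_alt)
  case (step c x y)
  from step(1) have "wedge_coord il x = 0"
  proof (elim UnE CollectE exE conjE)
    fix us ws :: "'v list" and j c' y z
    assume "x = gen (us[j := scale c' y + z]) ws - fscale c' (gen (us[j := y]) ws)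
        - gen (us[j := z]) ws" "length us = b" "j < b"
    then show ?thesis
      by (simp add: wedge_coord_minus wedge_coord_fscale wedge_coord_gen minor_lin free.scale_left_distrib)
  next
    fix us ws :: "'v list" and j c' y z
    assume "x = gen us (ws[j := scale c' y + z]) - fscale c' (gen us (ws[j := y]))
        - gen us (ws[j := z])" "length ws = a" "j < a"
    then show ?thesis
      by (simp add: wedge_coord_minus wedge_coord_fscale wedge_coord_gen symprod_lin free.scale_right_distrib
          mult.commute)
  next
    fix us ws :: "'v list"
    assume "x = gen us ws" "\<not> distinct us"
    then show ?thesis by (simp add: wedge_coord_gen minor_not_distinct)
  next
    fix us ws ws' :: "'v list"
    assume "x = gen us ws - gen us ws'" "mset ws' = mset ws"
    then show ?thesis using symprod_cong_mset[of ws' ws] by (simp add: wedge_coord_minus wedge_coord_gen)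
  qed
  then show ?case using step(2) by (simp add: wedge_coord_add wedge_coord_fscale)
qed simp

text \<open>A vector \<open>u\<^sub>j\<close> that leaves the wedge enters the polynomial as a linear form. Collecting the terms with
  the \<open>i\<close>-th variable gives the Laplace expansion of the minor with \<open>i\<close> appended as a last row.\<close>

lemma wedge_coord_koszul: "wedge_coord il (koszul x) = (\<Sum>i = 1..n. var i * wedge_coord (il @ [i]) x)"
proof -
  have gen: "wedge_coord il (koszul (gen us ws)) = (\<Sum>i = 1..n. var i * wedge_coord (il @ [i]) (gen us ws))" for us ws
  proof -
    have "wedge_coord il (koszul (gen us ws)) = (\<Sum>j<length us. \<Sum>i = 1..n.
        fscale ((-1) ^ (length us - Suc j) * coord i (us ! j)
          * minor il (take j us @ drop (Suc j) us)) (var i * symprod ws))"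
      by (simp add: koszul_gen wedge_coord_sum wedge_coord_fscale wedge_coord_gen symprod_Cons linform_times
          free.scale_sum_right) (simp add: mult_ac)
    also have "\<dots> = (\<Sum>i = 1..n. var i * wedge_coord (il @ [i]) (gen us ws))"
      by (subst sum.swap) (simp add: wedge_coord_gen minor_snoc free.scale_sum_left fscale_mult_right sum_distrib_left)
    finally show ?thesis .
  qed
  show ?thesis
    by (induction x rule: ws_induct)
      (simp_all add: koszul_add koszul_fscale wedge_coord_add wedge_coord_fscale gen free.scale_sum_right
        sum.distrib distrib_left fscale_mult_right)
qed

text \<open>Applying the Koszul map twice appends two rows \<open>i\<close>, \<open>j\<close> and multiplies by the product of the two
  variables. The product is symmetric in \<open>i\<close> and \<open>j\<close>, the minor antisymmetric.\<close>

lemma wedge_coord_koszul_koszul: "wedge_coord il (koszul (koszul x)) = 0"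
proof -
  define f where "f i j = var i * (var j * wedge_coord (il @ [i, j]) x)" for i j
  \<comment> \<open>In characteristic 2 this does not follow from antisymmetry; it needs that a minor with two equal rows vanishes.\<close>
  have diag: "f i i = 0" for i
  proof -
    have "wedge_coord (il @ [i, i]) x = 0"
      unfolding wedge_coord_def lin_ext_def
      by (intro sum.neutral) (auto simp: minor_rows_not_distinct)
    then show ?thesis by (simp add: f_def)
  qed
  have anti: "f i j = - f j i" for i j
  proof -
    have "wedge_coord (il @ [i, j]) x = - wedge_coord (il @ [j, i]) x"
      unfolding wedge_coord_def lin_ext_def
      by (simp add: minor_swap[of il i j "[]"] sum_negf[symmetric] split_beta)
    then show ?thesis by (simp add: f_def ac_simps)
  qed
  have "wedge_coord il (koszul (koszul x)) = (\<Sum>i = 1..n. \<Sum>j = 1..n. f i j)"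
    by (simp add: wedge_coord_koszul sum_distrib_left f_def)
  also have "\<dots> = 0"
  proof -
    have "(\<Sum>i = 1..k. \<Sum>j = 1..k. f i j) = 0" for k
    proof (induction k)
      case (Suc k)
      have "(\<Sum>i = 1..k. f i (Suc k)) = - (\<Sum>i = 1..k. f (Suc k) i)"
        by (simp add: sum_negf[symmetric] anti[of _ "Suc k"])
      then show ?case using Suc by (simp add: sum.distrib diag)
    qed simp
    then show ?thesis .
  qed
  finally show ?thesis .
qed

end

section \<open>The basis \<open>v\<^sub>I \<otimes> v\<^sup>\<alpha>\<close>\<close>

text \<open>Insertion sort only exchanges neighbours. This is used for the rows of a minor and for the factors of
  a wedge product.\<close>

lemma adjacent_swaps_sort:
  fixes xs :: "'a::linorder list"
  assumes swap: "\<And>pre x y suf. Q (pre @ x # y # suf) (pre @ y # x # suf)"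
    and refl: "\<And>xs. Q xs xs"
    and trans: "\<And>xs ys zs. Q xs ys \<Longrightarrow> Q ys zs \<Longrightarrow> Q xs zs"
  shows "Q xs (sort xs)"
proof -
  have insort: "Q (pre @ x # xs) (pre @ insort x xs)" for pre x and xs :: "'a list"
  proof (induction xs arbitrary: pre)
    case (Cons y ys)
    show ?case
      using trans[OF swap[of pre x y ys]] Cons[of "pre @ [y]"] refl by auto
  qed (simp add: refl)
  have "Q (pre @ xs) (pre @ sort xs)" for pre
  proof (induction xs arbitrary: pre)
    case (Cons x xs)
    show ?case using trans[OF _ insort] Cons[of "pre @ [x]"] by simp
  qed (simp add: refl)
  from this[of "[]"] show ?thesis by simp
qed

context based_space
begin

lemma symprod_basis: "set js \<subseteq> {1..n} \<Longrightarrow> symprod (map v js) = Poly_Mapping.single (weight js) 1"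
  by (induction js) (auto simp: symprod_def weight_def linform_v var_def mult_single)

text \<open>The factor is the sign of the permutation that sorts \<open>il\<close>.\<close>

lemma minor_sort: "\<exists>\<epsilon>. \<epsilon> \<noteq> 0 \<and> (\<forall>us. minor il us = \<epsilon> * minor (sort il) us)"
proof (rule adjacent_swaps_sort)
  show "\<exists>\<epsilon>. \<epsilon> \<noteq> 0 \<and> (\<forall>us. minor (pre @ x # y # suf) us = \<epsilon> * minor (pre @ y # x # suf) us)"
    for pre x y suf
    by (rule exI[of _ "-1"]) (simp add: minor_swap[of pre x y suf])
  show "\<exists>\<epsilon>. \<epsilon> \<noteq> 0 \<and> (\<forall>us. minor xs us = \<epsilon> * minor xs us)" for xs
    by (rule exI[of _ 1]) simp
  fix xs ys zs
  assume "\<exists>\<epsilon>. \<epsilon> \<noteq> 0 \<and> (\<forall>us. minor xs us = \<epsilon> * minor ys us)"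
    and "\<exists>\<epsilon>. \<epsilon> \<noteq> 0 \<and> (\<forall>us. minor ys us = \<epsilon> * minor zs us)"
  then obtain \<epsilon> \<delta> where "\<epsilon> \<noteq> 0" "\<delta> \<noteq> 0"
    "\<forall>us. minor xs us = \<epsilon> * minor ys us" "\<forall>us. minor ys us = \<delta> * minor zs us"
    by blast
  then show "\<exists>\<epsilon>. \<epsilon> \<noteq> 0 \<and> (\<forall>us. minor xs us = \<epsilon> * minor zs us)"
    by (intro exI[of _ "\<epsilon> * \<delta>"]) simp
qed

text \<open>For different \<open>I\<close> and \<open>J\<close> of equal size, some \<open>j \<in> J\<close> is missing in \<open>I\<close>, and the column of \<open>v\<^sub>j\<close>
  vanishes.\<close>

lemma minor_basis:
  assumes "I \<subseteq> {1..n}" "J \<subseteq> {1..n}"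
  shows "minor (sorted_list_of_set I) (map v (sorted_list_of_set J)) = (if I = J then 1 else 0)"
proof -
  have fin: "finite I" "finite J" using assms by (auto intro: finite_subset)
  define il where "il = sorted_list_of_set I"
  define jl where "jl = sorted_list_of_set J"
  have [simp]: "set il = I" "set jl = J" "distinct il" "length il = card I" "length jl = card J"
    using fin by (simp_all add: il_def jl_def)
  show ?thesis
  proof (cases "I = J")
    case True
    have "il ! r \<in> {1..n}" if "r < card I" for r
      using nth_mem[of r il] that assms by auto
    then have "minor_mat il (map v il) = 1\<^sub>m (card I)"
      by (intro eq_matI) (auto simp: minor_mat_def coord_v nth_eq_iff_index_eq)
    then have "minor il (map v il) = 1" by (simp add: minor_def)
    then show ?thesis using True by (simp add: il_def)
  next
    case False
    have "minor il (map v jl) = 0" if card: "card I = card J"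
    proof -
      obtain j where "j \<in> J" "j \<notin> I"
        using False card fin by (metis card_subset_eq subsetI)
      then obtain c where c: "c < card J" "jl ! c = j"
        by (metis \<open>set jl = J\<close> \<open>length jl = card J\<close> in_set_conv_nth)
      have "minor_mat il (map v jl) $$ (p c, c) = 0" if "p permutes {0..<card J}" for p
      proof -
        have "p c < card J" using that c permutes_in_image[of p "{0..<card J}" c] by simp
        moreover from this have "il ! p c \<in> I" using card nth_mem[of "p c" il] by simp
        ultimately show ?thesis
          using c \<open>j \<in> J\<close> \<open>j \<notin> I\<close> assms card
          by (auto simp: minor_mat_def subset_iff intro!: coord_v[THEN trans])
      qed
      then have prod: "(\<Prod>c<card J. minor_mat il (map v jl) $$ (p c, c)) = 0"
        if "p permutes {0..<card J}" for p
        using that c(1) by (intro prod_zero) auto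
      have "det (minor_mat il (map v jl)) = (\<Sum>p | p permutes {0..<card J}.
          signof p * (\<Prod>c<card J. minor_mat il (map v jl) $$ (p c, c)))"
        using card det_col[OF minor_mat_carrier, of il "map v jl"] by simp
      also have "\<dots> = 0"
      proof (rule sum.neutral, rule ballI)
        fix p assume "p \<in> {p. p permutes {0..<card J}}"
        then show "signof p * (\<Prod>c<card J. minor_mat il (map v jl) $$ (p c, c)) = 0"
          using prod[of p] by (simp only: mem_Collect_eq mult_zero_right)
      qed
      finally have "det (minor_mat il (map v jl)) = 0" .
      then show ?thesis by (simp add: minor_def)
    qed
    then show ?thesis using False by (auto simp: minor_def simp flip: il_def jl_def)
  qed
qed

lemma wedge_coord_basis:
  assumes "I \<subseteq> {1..n}" "J \<subseteq> {1..n}" "Poly_Mapping.keys \<alpha> \<subseteq> {1..n}"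
  shows "wedge_coord (sorted_list_of_set I) (basis_elt v n J \<alpha>)
           = (if I = J then Poly_Mapping.single \<alpha> 1 else 0)"
  using assms minor_basis[OF assms(1,2)]
  by (simp add: basis_elt_word wedge_coord_gen symprod_basis set_word weight_word)

lemma wedge_coord_sort:
  assumes "distinct il"
  obtains \<epsilon> where "\<epsilon> \<noteq> 0" "\<And>x. wedge_coord il x = fscale \<epsilon> (wedge_coord (sorted_list_of_set (set il)) x)"
proof -
  obtain \<epsilon> where \<epsilon>: "\<epsilon> \<noteq> 0" "\<And>us. minor il us = \<epsilon> * minor (sort il) us"
    using minor_sort[of il] by blast
  have "sort il = sorted_list_of_set (set il)"
    using assms by (simp add: sorted_list_of_set_sort_remdups distinct_remdups_id)
  then have "wedge_coord il x = fscale \<epsilon> (wedge_coord (sorted_list_of_set (set il)) x)" for x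
    by (simp add: wedge_coord_def lin_ext_def \<epsilon>(2) free.scale_sum_right split_beta mult_ac)
  then show ?thesis using that \<epsilon>(1) by blast
qed

lemma wedge_coord_not_distinct: "\<not> distinct il \<Longrightarrow> wedge_coord il x = 0"
  by (simp add: wedge_coord_def lin_ext_def minor_rows_not_distinct split_beta)

text \<open>The indices of the basis elements \<open>v\<^sub>I \<otimes> v\<^sup>\<alpha>\<close> of \<open>\<Lambda>\<^sup>b V \<otimes> S\<^sub>a(V)\<close>.\<close>

definition tensor_index :: "nat \<Rightarrow> nat \<Rightarrow> (nat set \<times> monomial) set" where
  "tensor_index b a = {(I, \<alpha>). I \<subseteq> {1..n} \<and> card I = b \<and> \<alpha> \<in> exps {1..n} a}"

lemma finite_tensor_index: "finite (tensor_index b a)"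
proof (rule finite_subset)
  show "tensor_index b a \<subseteq> Pow {1..n} \<times> exps {1..n} a" by (auto simp: tensor_index_def)
qed (simp add: finite_exps)

text \<open>Expand the arguments in the basis one after the other, from left to right.\<close>

lemma multilinear_induct:
  assumes zero: "\<And>us j. j < length us \<Longrightarrow> length us = k \<Longrightarrow> P (us[j := 0])"
    and lin: "\<And>us j c x y. j < length us \<Longrightarrow> length us = k \<Longrightarrow> P (us[j := x]) \<Longrightarrow> P (us[j := y])
      \<Longrightarrow> P (us[j := scale c x + y])"
    and basis: "\<And>il. set il \<subseteq> {1..n} \<Longrightarrow> length il = k \<Longrightarrow> P (map v il)"
    and len: "length us = k"
  shows "P us"
proof -
  have "P (map v il @ us)" if "set il \<subseteq> {1..n}" "length il + length us = k" for il us
    using that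
  proof (induction us arbitrary: il)
    case Nil
    then show ?case using basis by simp
  next
    case (Cons u us)
    let ?l = "map v il @ 0 # us" and ?j = "length il"
    have upd: "?l[?j := z] = map v il @ z # us" for z
      by (simp add: list_update_append)
    have "u \<in> span (v ` {1..n})" by (simp add: span_v del: One_nat_def)
    then have "P (?l[?j := u])"
    proof (induction rule: span_induct_alt)
      case base
      then show ?case using zero[of ?j ?l] Cons.prems by simp
    next
      case (step c x y)
      then obtain i where i: "i \<in> {1..n}" "x = v i" by auto
      have "P (?l[?j := x])"
        unfolding upd using Cons.IH[of "il @ [i]"] Cons.prems i by simp
      then show ?case using lin[of ?j ?l] step(2) Cons.prems by simp
    qed
    then show ?case by (simp only: upd)
  qed
  from this[of "[]" us] len show ?thesis by simp
qed

text \<open>By multilinearity it is enough to treat generators all of whose arguments are basis vectors. Those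
  with a repetition in the wedge vanish; the others can be sorted, since \<open>(x + y) \<and> (x + y)\<close>, \<open>x \<and> x\<close>
  and \<open>y \<and> y\<close> vanish, so that exchanging neighbours only changes the sign.\<close>

lemma span_basis_elt:
  "ws_free b a \<subseteq> free.span ((\<lambda>(I, \<alpha>). basis_elt v n I \<alpha>) ` tensor_index b a \<union> ws_rel scale b a)"
    (is "_ \<subseteq> ?W")
proof -
  let ?R = "ws_rel scale b a"
  have W: "free.subspace ?W" by simp
  have R: "?R \<subseteq> ?W" by (rule order_trans[OF _ free.span_superset]) simp
  have mod: "x \<in> ?W \<longleftrightarrow> y \<in> ?W" if "x - y \<in> ?R" for x y
    using R that free.subspace_add[OF W, of "x - y" y] free.subspace_diff[OF W, of x "x - y"] by auto
  have sorted: "gen (map v il) (map v jl) \<in> ?W"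
    if "set il \<subseteq> {1..n}" "set jl \<subseteq> {1..n}" "distinct il" "sorted il" "length il = b" "length jl = a"
    for il jl
  proof -
    let ?\<alpha> = "weight jl"
    have "mset (word n ?\<alpha>) = mset jl"
      using that(2) by (simp add: weight_word keys_weight flip: weight_eq_iff)
    then have "mset (map v (word n ?\<alpha>)) = mset (map v jl)" by simp
    then have "gen (map v il) (map v jl) - gen (map v il) (map v (word n ?\<alpha>)) \<in> ?R"
      using that by (intro ws_rel_symmetric) auto
    moreover have "gen (map v il) (map v (word n ?\<alpha>)) \<in> ?W"
    proof (rule free.span_base, rule UnI1, rule image_eqI)
      show "(set il, ?\<alpha>) \<in> tensor_index b a"
        using that weight_exps[of jl "{1..n}"] by (auto simp: tensor_index_def distinct_card)
      show "gen (map v il) (map v (word n ?\<alpha>)) = (case (set il, ?\<alpha>) of (I, \<alpha>) \<Rightarrow> basis_elt v n I \<alpha>)"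
        using that by (simp add: basis_elt_word sorted_list_of_set_sort_remdups distinct_remdups_id sorted_sort_id)
    qed
    ultimately show ?thesis using mod by blast
  qed
  have swap: "gen (pre @ x # y # suf) ws \<in> ?W \<longleftrightarrow> gen (pre @ y # x # suf) ws \<in> ?W"
    if "length pre + length suf + 2 = b" "length ws = a" for pre x y suf and ws :: "'v list"
  proof -
    let ?g = "\<lambda>s t. gen (pre @ s # t # suf) ws"
    have lin1: "?g (x + y) t - ?g x t - ?g y t \<in> ?R" for t
      using ws_rel_lin_left[of "pre @ 0 # t # suf" b ws a "length pre" scale 1 x y] that
      by (simp add: list_update_append)
    have lin2: "?g s (x + y) - ?g s x - ?g s y \<in> ?R" for s
      using ws_rel_lin_left[of "pre @ s # 0 # suf" b ws a "Suc (length pre)" scale 1 x y] that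
      by (simp add: list_update_append)
    have alt: "?g s s \<in> ?R" for s
      using that by (intro ws_rel_alternating) auto
    note intros = free.subspace_diff[OF subspace_ws_rel] free.subspace_add[OF subspace_ws_rel]
    have "?g (x + y) (x + y) - (?g (x + y) (x + y) - ?g x (x + y) - ?g y (x + y))
        - (?g x (x + y) - ?g x x - ?g x y) - (?g y (x + y) - ?g y x - ?g y y) - ?g x x - ?g y y \<in> ?R"
      by (intro intros alt lin1 lin2)
    then have "?g x y + ?g y x \<in> ?R" by (simp add: algebra_simps)
    then have "?g x y \<in> ?W \<longleftrightarrow> - ?g y x \<in> ?W" by (intro mod) simp
    then show ?thesis using free.subspace_neg[OF W] by (metis minus_minus)
  qed
  have basis: "gen (map v il) (map v jl) \<in> ?W"
    if il: "set il \<subseteq> {1..n}" "length il = b" and jl: "set jl \<subseteq> {1..n}" "length jl = a" for il jl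
  proof (cases "distinct il")
    case True
    have "length (sort il) = length il \<and> (length il = b \<longrightarrow>
        (gen (map v il) (map v jl) \<in> ?W \<longleftrightarrow> gen (map v (sort il)) (map v jl) \<in> ?W))"
      by (rule adjacent_swaps_sort[of "\<lambda>il il'. length il' = length il \<and> (length il = b \<longrightarrow>
          (gen (map v il) (map v jl) \<in> ?W \<longleftrightarrow> gen (map v il') (map v jl) \<in> ?W))"])
        (auto simp: swap jl)
    moreover have "gen (map v (sort il)) (map v jl) \<in> ?W"
      using il jl True by (intro sorted) auto
    ultimately show ?thesis using il by blast
  next
    case False
    then have "\<not> distinct (map v il)" by (simp add: distinct_map)
    then show ?thesis using R il jl by (auto intro!: ws_rel_alternating)
  qed
  have comb: "x \<in> ?W" if "x - fscale c y - z \<in> ?R" "y \<in> ?W" "z \<in> ?W" for x c y z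
    using mod[of x "fscale c y + z"] that free.subspace_add[OF W] free.subspace_scale[OF W]
    by (simp add: diff_diff_eq)
  have zero_left: "gen (us[j := 0]) ws \<in> ?R" if "length us = b" "length ws = a" "j < b"
    for us ws :: "'v list" and j
    using ws_rel_lin_left[OF that, of scale 1 0 0] free.subspace_neg[OF subspace_ws_rel] by force
  have zero_right: "gen us (ws[j := 0]) \<in> ?R" if "length us = b" "length ws = a" "j < a"
    for us ws :: "'v list" and j
    using ws_rel_lin_right[OF that, of scale 1 0 0] free.subspace_neg[OF subspace_ws_rel] by force
  have left: "gen us (map v jl) \<in> ?W" if "length us = b" "set jl \<subseteq> {1..n}" "length jl = a" for us jl
  proof (rule multilinear_induct[of b "\<lambda>us. gen us (map v jl) \<in> ?W"])
    fix us :: "'v list" and j c x y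
    assume "j < length us" "length us = b" "gen (us[j := x]) (map v jl) \<in> ?W"
      "gen (us[j := y]) (map v jl) \<in> ?W"
    then show "gen (us[j := scale c x + y]) (map v jl) \<in> ?W"
      using that by (intro comb[OF ws_rel_lin_left]) simp_all
  next
    show "gen (us[j := 0]) (map v jl) \<in> ?W" if "j < length us" "length us = b" for us j
      using zero_left[of us "map v jl" j] that \<open>length jl = a\<close> R by auto
  qed (use that basis in simp_all)
  have "gen us ws \<in> ?W" if "length us = b" "length ws = a" for us ws :: "'v list"
  proof (rule multilinear_induct[of a "\<lambda>ws. gen us ws \<in> ?W"])
    fix ws :: "'v list" and j c x y
    assume "j < length ws" "length ws = a" "gen us (ws[j := x]) \<in> ?W" "gen us (ws[j := y]) \<in> ?W"
    then show "gen us (ws[j := scale c x + y]) \<in> ?W"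
      using that by (intro comb[OF ws_rel_lin_right]) simp_all
  next
    show "gen us (ws[j := 0]) \<in> ?W" if "j < length ws" "length ws = a" for ws j
      using zero_right[of us ws j] that \<open>length us = b\<close> R by auto
  qed (use that left in simp_all)
  then show ?thesis
    unfolding ws_free_def by (intro free.span_minimal W) auto
qed

text \<open>The coordinate of \<open>x\<close> at the basis element \<open>v\<^sub>I \<otimes> v\<^sup>\<alpha>\<close>.\<close>

definition coord_at :: "nat set \<Rightarrow> monomial \<Rightarrow> ('v, 'k) ws \<Rightarrow> 'k" where
  "coord_at I \<alpha> x = Poly_Mapping.lookup (wedge_coord (sorted_list_of_set I) x) \<alpha>"

lemma coord_at_add: "coord_at I \<alpha> (x + y) = coord_at I \<alpha> x + coord_at I \<alpha> y"
  and coord_at_minus: "coord_at I \<alpha> (x - y) = coord_at I \<alpha> x - coord_at I \<alpha> y"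
  and coord_at_fscale: "coord_at I \<alpha> (fscale c x) = c * coord_at I \<alpha> x"
  and coord_at_sum: "coord_at I \<alpha> (\<Sum>h\<in>H. f h) = (\<Sum>h\<in>H. coord_at I \<alpha> (f h))"
  by (simp_all add: coord_at_def wedge_coord_add wedge_coord_minus wedge_coord_fscale wedge_coord_sum lookup_add lookup_minus lookup_sum)

lemma coord_at_zero [simp]: "coord_at I \<alpha> 0 = 0"
  by (simp add: coord_at_def)

lemma coord_at_ws_rel: "x \<in> ws_rel scale b a \<Longrightarrow> coord_at I \<alpha> x = 0"
  by (simp add: coord_at_def wedge_coord_ws_rel)

lemma coord_at_basis_elt:
  assumes "I \<subseteq> {1..n}" "J \<subseteq> {1..n}" "Poly_Mapping.keys \<beta> \<subseteq> {1..n}"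
  shows "coord_at I \<alpha> (basis_elt v n J \<beta>) = (if I = J \<and> \<alpha> = \<beta> then 1 else 0)"
  using wedge_coord_basis[OF assms] by (simp add: coord_at_def lookup_single when_def)

lemma tensor_indexD:
  assumes "(I, \<alpha>) \<in> tensor_index b a"
  shows "I \<subseteq> {1..n}" "finite I" "card I = b" "Poly_Mapping.keys \<alpha> \<subseteq> {1..n}" "\<alpha> \<in> exps {1..n} a"
  using assms by (auto simp: tensor_index_def exps_def intro: finite_subset)

lemma basis_elt_in_ws_free:
  assumes "(I, \<alpha>) \<in> tensor_index b a"
  shows "basis_elt v n I \<alpha> \<in> ws_free b a"
  using assms unfolding basis_elt_word
  by (intro gen_in_ws_free) (auto simp: tensor_index_def exps_def length_word)

lemma coord_at_index:
  assumes "(I, \<alpha>) \<in> tensor_index b a" "(J, \<beta>) \<in> tensor_index b a"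
  shows "coord_at I \<alpha> (basis_elt v n J \<beta>) = (if (I, \<alpha>) = (J, \<beta>) then 1 else 0)"
  using coord_at_basis_elt[OF tensor_indexD(1)[OF assms(1)] tensor_indexD(1,4)[OF assms(2)]] by simp

text \<open>The elements with this property form a subspace, which contains the relations, as their coordinates
  vanish, and the \<open>v\<^sub>I \<otimes> v\<^sup>\<alpha>\<close>, as their coordinates are \<open>0\<close> and \<open>1\<close>. By \<open>span_basis_elt\<close> it is everything.\<close>

lemma expansion:
  assumes "x \<in> ws_free b a"
  shows "x - (\<Sum>(I, \<alpha>)\<in>tensor_index b a. fscale (coord_at I \<alpha> x) (basis_elt v n I \<alpha>)) \<in> ws_rel scale b a"
    (is "?D x \<in> ?R")
proof -
  have "x \<in> free.span ((\<lambda>(I, \<alpha>). basis_elt v n I \<alpha>) ` tensor_index b a \<union> ?R)"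
    using span_basis_elt assms by blast
  then show ?thesis
  proof (induction rule: free.span_induct_alt)
    case base
    then show ?case by (simp add: free.subspace_0[OF subspace_ws_rel] split_beta)
  next
    case (step c x y)
    have "?D x \<in> ?R"
    proof (cases "x \<in> ?R")
      case True
      then show ?thesis by (simp add: coord_at_ws_rel split_beta)
    next
      case False
      then obtain J \<beta> where J: "(J, \<beta>) \<in> tensor_index b a" "x = basis_elt v n J \<beta>" using step(1) by auto
      have "(\<Sum>(I, \<alpha>)\<in>tensor_index b a. fscale (coord_at I \<alpha> x) (basis_elt v n I \<alpha>))
          = (\<Sum>p\<in>tensor_index b a. if p = (J, \<beta>) then x else 0)"
        using J coord_at_index[OF _ J(1)] by (intro sum.cong) (auto split: prod.split if_splits)
      also have "\<dots> = x" using J finite_tensor_index by simp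
      finally show ?thesis by (simp add: free.subspace_0[OF subspace_ws_rel])
    qed
    then have "fscale c (?D x) + ?D y \<in> ?R"
      using step(2) free.subspace_add[OF subspace_ws_rel] free.subspace_scale[OF subspace_ws_rel]
      by blast
    also have "fscale c (?D x) + ?D y = ?D (fscale c x + y)"
      by (simp add: coord_at_add coord_at_fscale free.scale_left_distrib free.scale_right_diff_distrib
          sum.distrib split_beta free.scale_sum_right)
    finally show ?case .
  qed
qed

text \<open>With this criterion, statements about the Koszul map modulo the relations follow from the formula
  \<open>wedge_coord_koszul\<close>.\<close>

lemma ws_rel_iff_coord_at:
  assumes "x \<in> ws_free b a"
  shows "x \<in> ws_rel scale b a \<longleftrightarrow> (\<forall>(I, \<alpha>)\<in>tensor_index b a. coord_at I \<alpha> x = 0)"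
proof
  assume "\<forall>(I, \<alpha>)\<in>tensor_index b a. coord_at I \<alpha> x = 0"
  then have "(\<Sum>(I, \<alpha>)\<in>tensor_index b a. fscale (coord_at I \<alpha> x) (basis_elt v n I \<alpha>)) = 0"
    by (intro sum.neutral) auto
  then show "x \<in> ws_rel scale b a" using expansion[OF assms] by simp
qed (auto simp: coord_at_ws_rel)

section \<open>Characters\<close>

lemma coord_at_homogeneous:
  assumes "x \<in> homogeneous v n (ws_rel scale b a) \<mu>" "I \<subseteq> {1..n}" "mdeg I \<alpha> \<noteq> \<mu>"
  shows "coord_at I \<alpha> x = 0"
  using assms(1) unfolding homogeneous_def
proof (induction rule: free.span_induct_alt)
  case (step c x y)
  then have "coord_at I \<alpha> x = 0"
    using assms(2,3) by (auto simp: coord_at_ws_rel coord_at_basis_elt)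
  then show ?case using step(2) by (simp add: coord_at_add coord_at_fscale)
qed simp

lemma homogeneousI:
  assumes x: "x \<in> ws_free b a"
    and deg: "\<And>I \<alpha>. (I, \<alpha>) \<in> tensor_index b a \<Longrightarrow> coord_at I \<alpha> x \<noteq> 0 \<Longrightarrow> mdeg I \<alpha> = \<mu>"
  shows "x \<in> homogeneous v n (ws_rel scale b a) \<mu>" (is "_ \<in> ?H")
proof -
  have H: "free.subspace ?H" by (simp add: homogeneous_def)
  have "ws_rel scale b a \<subseteq> ?H"
    unfolding homogeneous_def by (rule order_trans[OF _ free.span_superset]) simp
  moreover have "(\<Sum>(I, \<alpha>)\<in>tensor_index b a. fscale (coord_at I \<alpha> x) (basis_elt v n I \<alpha>)) \<in> ?H"
    (is "?s \<in> _")
  proof (rule free.subspace_sum[OF H], safe)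
    fix I \<alpha> assume p: "(I, \<alpha>) \<in> tensor_index b a"
    show "fscale (coord_at I \<alpha> x) (basis_elt v n I \<alpha>) \<in> ?H"
    proof (cases "coord_at I \<alpha> x = 0")
      case False
      then have "basis_elt v n I \<alpha> \<in> ?H"
        unfolding homogeneous_def using deg[OF p] tensor_indexD[OF p] by (intro free.span_base) blast
      then show ?thesis by (rule free.subspace_scale[OF H])
    qed (simp add: free.subspace_0[OF H])
  qed
  ultimately have "(x - ?s) + ?s \<in> ?H"
    using expansion[OF x] by (intro free.subspace_add[OF H]) auto
  then show ?thesis by simp
qed

text \<open>The coordinates embed the quotient into a free space. The elements of \<open>B\<close> of degree \<open>\<mu>\<close> stay
  independent there. Each of them is a combination of elements of \<open>B'\<close>, and only those of degree \<open>\<mu>\<close>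
  are needed, because the coordinates in any other degree vanish. Now the exchange lemma applies.\<close>

lemma card_graded_basis_le:
  assumes K: "K \<subseteq> ws_free b a"
    and B: "multigraded_basis v n (K, ws_rel scale b a) B d" "finite B"
    and B': "multigraded_basis v n (K, ws_rel scale b a) B' d'" "finite B'"
  shows "card {x \<in> B. d x = \<mu>} \<le> card {x \<in> B'. d' x = \<mu>}"
proof -
  let ?R = "ws_rel scale b a"
  define \<Phi> where "\<Phi> x = (\<Sum>p\<in>tensor_index b a. Poly_Mapping.single p (coord_at (fst p) (snd p) x))" for x
  have lookup: "Poly_Mapping.lookup (\<Phi> x) p = (if p \<in> tensor_index b a then coord_at (fst p) (snd p) x else 0)"
    for x p
    using finite_tensor_index by (auto simp: \<Phi>_def lookup_sum lookup_single when_def)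
  have lin: "\<Phi> (\<Sum>x\<in>S. fscale (c x) x) = (\<Sum>x\<in>S. fscale (c x) (\<Phi> x))" for S c
    by (rule poly_mapping_eqI) (simp add: lookup lookup_sum coord_at_sum coord_at_fscale)
  have rel: "x \<in> ?R" if "\<Phi> x = 0" "x \<in> ws_free b a" for x
    using that lookup[of x] by (auto simp: ws_rel_iff_coord_at) (metis fst_conv snd_conv lookup_zero)
  have BK: "B \<subseteq> K" "B' \<subseteq> K" "free.span (B' \<union> ?R) = K"
    and indep: "\<And>F c x. finite F \<Longrightarrow> F \<subseteq> B \<Longrightarrow> (\<Sum>x\<in>F. fscale (c x) x) \<in> ?R \<Longrightarrow> x \<in> F \<Longrightarrow> c x = 0"
    and hom: "\<And>x. x \<in> B \<Longrightarrow> x \<in> homogeneous v n ?R (d x)"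
    and hom': "\<And>x. x \<in> B' \<Longrightarrow> x \<in> homogeneous v n ?R (d' x)"
    using B(1) B'(1) by (auto simp: multigraded_basis_def)
  let ?S = "{x \<in> B. d x = \<mu>}" and ?T = "{x \<in> B'. d' x = \<mu>}"
  have zero: "c x = 0" if "(\<Sum>x\<in>?S. fscale (c x) (\<Phi> x)) = 0" "x \<in> ?S" for c x
  proof -
    have "(\<Sum>x\<in>?S. fscale (c x) x) \<in> ?R"
      using that BK K by (intro rel) (auto simp: lin intro!: free.subspace_sum[OF subspace_ws_free]
          free.subspace_scale[OF subspace_ws_free])
    then show ?thesis using indep[of ?S c x] that(2) \<open>finite B\<close> by auto
  qed
  have inj: "inj_on \<Phi> ?S"
  proof (rule inj_onI, rule ccontr)
    fix x y assume xy: "x \<in> ?S" "y \<in> ?S" "\<Phi> x = \<Phi> y" "x \<noteq> y"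
    let ?c = "\<lambda>z. if z = x then 1 else if z = y then -1 else 0"
    have "(\<Sum>z\<in>?S. fscale (?c z) (\<Phi> z)) = (\<Sum>z\<in>{x, y}. fscale (?c z) (\<Phi> z))"
      using xy \<open>finite B\<close> by (intro sum.mono_neutral_right) auto
    also have "\<dots> = 0" using xy by simp
    finally show False using zero[of ?c x] xy by simp
  qed
  have "free.independent (\<Phi> ` ?S)"
  proof (rule free.independent_if_scalars_zero)
    fix c x assume c: "(\<Sum>y\<in>\<Phi> ` ?S. fscale (c y) y) = 0" "x \<in> \<Phi> ` ?S"
    then show "c x = 0"
      using zero[of "\<lambda>x. c (\<Phi> x)"] by (auto simp: sum.reindex[OF inj])
  qed (use \<open>finite B\<close> in simp)
  moreover have "\<Phi> ` ?S \<subseteq> free.span (\<Phi> ` ?T)"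
  proof (rule image_subsetI)
    fix x assume x: "x \<in> ?S"
    then have "x \<in> free.span (B' \<union> ?R)" using BK by auto
    then obtain y r where yr: "x = y + r" "y \<in> free.span B'" "r \<in> ?R"
      unfolding free.span_Un free.span_eq_iff[THEN iffD2, OF subspace_ws_rel] by blast
    then obtain c where c: "y = (\<Sum>z\<in>B'. fscale (c z) z)"
      using \<open>finite B'\<close> by (auto simp: free.span_finite)
    have "\<Phi> x = (\<Sum>z\<in>?T. fscale (c z) (\<Phi> z))"
    proof (rule poly_mapping_eqI)
      fix p :: "nat set \<times> monomial"
      obtain I \<alpha> where p: "p = (I, \<alpha>)" by fastforce
      show "Poly_Mapping.lookup (\<Phi> x) p = Poly_Mapping.lookup (\<Sum>z\<in>?T. fscale (c z) (\<Phi> z)) p"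
      proof (cases "p \<in> tensor_index b a")
        case True
        then have I: "I \<subseteq> {1..n}" using p tensor_indexD by blast
        have "coord_at I \<alpha> x = (\<Sum>z\<in>?T. c z * coord_at I \<alpha> z)"
        proof (cases "mdeg I \<alpha> = \<mu>")
          case True
          have "coord_at I \<alpha> x = (\<Sum>z\<in>B'. c z * coord_at I \<alpha> z)"
            using yr c by (simp add: coord_at_add coord_at_sum coord_at_fscale coord_at_ws_rel)
          also have "\<dots> = (\<Sum>z\<in>?T. c z * coord_at I \<alpha> z)"
          proof (rule sum.mono_neutral_right)
            show "\<forall>z\<in>B' - ?T. c z * coord_at I \<alpha> z = 0"
            proof
              fix z assume "z \<in> B' - ?T"
              then have "coord_at I \<alpha> z = 0"
                using True by (intro coord_at_homogeneous[OF hom' I]) auto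
              then show "c z * coord_at I \<alpha> z = 0" by simp
            qed
          qed (use \<open>finite B'\<close> in auto)
          finally show ?thesis .
        next
          case False
          then show ?thesis
            using x coord_at_homogeneous[OF hom I] coord_at_homogeneous[OF hom' I] by (simp cong: conj_cong)
        qed
        then show ?thesis using True p by (simp add: lookup lookup_sum)
      qed (simp add: lookup lookup_sum)
    qed
    also have "\<dots> \<in> free.span (\<Phi> ` ?T)"
      by (intro free.span_sum free.span_scale free.span_base) auto
    finally show "\<Phi> x \<in> free.span (\<Phi> ` ?T)" .
  qed
  ultimately have "card (\<Phi> ` ?S) \<le> card (\<Phi> ` ?T)"
    using free.independent_span_bound[of "\<Phi> ` ?T" "\<Phi> ` ?S"] \<open>finite B'\<close> by simp
  also have "\<dots> \<le> card ?T" using \<open>finite B'\<close> by (intro card_image_le) auto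
  finally show ?thesis by (simp add: card_image[OF inj])
qed

text \<open>Two multigraded bases contain equally many elements of each degree, so the definite description in
  \<open>ch\<close> denotes the sum over any of them.\<close>

lemma ch_eqI:
  assumes K: "K \<subseteq> ws_free b a"
    and B: "multigraded_basis v n (K, ws_rel scale b a) B d" "finite B"
  shows "ch v n (K, ws_rel scale b a) = (\<Sum>x\<in>B. monom (d x))"
  unfolding ch_def
proof (rule the_equality)
  fix p assume "\<exists>B d. finite B \<and> multigraded_basis v n (K, ws_rel scale b a) B d \<and>
    p = (\<Sum>x\<in>B. monom (d x))"
  then obtain B' d' where B': "finite B'" "multigraded_basis v n (K, ws_rel scale b a) B' d'"
    "p = (\<Sum>x\<in>B'. monom (d' x))" by blast
  have lookup: "Poly_Mapping.lookup (\<Sum>x\<in>S. monom (e x)) \<mu> = int (card {x \<in> S. e x = \<mu>})"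
    if "finite S" for S :: "('v, 'k) ws set" and e \<mu>
    using that by (simp add: Defs.monom_def lookup_sum lookup_single when_def sum.If_cases Int_def eq_commute[of \<mu>])
  show "p = (\<Sum>x\<in>B. monom (d x))"
    using card_graded_basis_le[OF K B B'(2,1)] card_graded_basis_le[OF K B'(2,1) B] B(2) B'(1)
    by (intro poly_mapping_eqI) (simp add: B'(3) lookup order_antisym)
qed (use B in blast)

text \<open>The coordinates chosen for the family are dual to it up to nonzero factors, which gives independence.
  It also gives generation: subtracting a suitable combination of the family from an element of \<open>K\<close>
  makes all chosen coordinates vanish, and then \<open>faithful\<close> puts the difference into the relations.\<close>

lemma ch_eq_dual_family:
  assumes K: "K \<subseteq> ws_free b a" "free.subspace K" "ws_rel scale b a \<subseteq> K"
    and fin: "finite H"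
    and z: "\<And>h. h \<in> H \<Longrightarrow> z h \<in> K"
    and hom: "\<And>h. h \<in> H \<Longrightarrow> z h \<in> homogeneous v n (ws_rel scale b a) (deg h)"
    and diag: "\<And>h. h \<in> H \<Longrightarrow> coord_at (I h) (\<alpha> h) (z h) \<noteq> 0"
    and off: "\<And>h h'. h \<in> H \<Longrightarrow> h' \<in> H \<Longrightarrow> h \<noteq> h' \<Longrightarrow> coord_at (I h) (\<alpha> h) (z h') = 0"
    and faithful: "\<And>x. x \<in> K \<Longrightarrow> (\<And>h. h \<in> H \<Longrightarrow> coord_at (I h) (\<alpha> h) x = 0) \<Longrightarrow> x \<in> ws_rel scale b a"
  shows "ch v n (K, ws_rel scale b a) = (\<Sum>h\<in>H. monom (deg h))"
proof -
  let ?R = "ws_rel scale b a"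
  have coord_at_comb: "coord_at (I h) (\<alpha> h) (\<Sum>g\<in>H. fscale (c g) (z g)) = c h * coord_at (I h) (\<alpha> h) (z h)"
    if "h \<in> H" for c h
  proof -
    have "coord_at (I h) (\<alpha> h) (\<Sum>g\<in>H. fscale (c g) (z g))
        = (\<Sum>g\<in>H. if g = h then c h * coord_at (I h) (\<alpha> h) (z h) else 0)"
      unfolding coord_at_sum using off that by (intro sum.cong) (auto simp: coord_at_fscale)
    then show ?thesis using fin that by simp
  qed
  have inj: "inj_on z H"
    using diag off by (metis inj_onI)
  define d where "d = deg \<circ> the_inv_into H z"
  have d: "d (z h) = deg h" if "h \<in> H" for h
    using that by (simp add: d_def the_inv_into_f_f[OF inj])
  have "multigraded_basis v n (K, ?R) (z ` H) d"
    unfolding multigraded_basis_def prod.case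
  proof (intro conjI allI impI ballI)
    show "z ` H \<subseteq> K" using z by blast
    show "free.span (z ` H \<union> ?R) = K"
    proof (rule antisym)
      show "free.span (z ` H \<union> ?R) \<subseteq> K" using z K by (intro free.span_minimal) auto
      show "K \<subseteq> free.span (z ` H \<union> ?R)"
      proof
        fix x assume x: "x \<in> K"
        define s where "s = (\<Sum>h\<in>H. fscale (coord_at (I h) (\<alpha> h) x / coord_at (I h) (\<alpha> h) (z h)) (z h))"
        have "s \<in> K" unfolding s_def
          using z by (intro free.subspace_sum[OF K(2)] free.subspace_scale[OF K(2)])
        then have "x - s \<in> ?R"
          using x diag by (intro faithful free.subspace_diff[OF K(2)])
            (simp_all add: coord_at_minus s_def coord_at_comb)
        then have "(x - s) + s \<in> free.span (z ` H \<union> ?R)"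
          unfolding s_def
          by (intro free.span_add free.span_sum free.span_scale free.span_base) auto
        then show "x \<in> free.span (z ` H \<union> ?R)" by simp
      qed
    qed
  next
    fix F c x
    assume F: "finite F \<and> F \<subseteq> z ` H \<and> (\<Sum>x\<in>F. fscale (c x) x) \<in> ?R" and "x \<in> F"
    then obtain h where h: "h \<in> H" "x = z h" by blast
    let ?c = "\<lambda>h. if z h \<in> F then c (z h) else 0"
    have "(\<Sum>x\<in>F. fscale (c x) x) = (\<Sum>x\<in>z ` H. fscale (if x \<in> F then c x else 0) x)"
      using F fin by (intro sum.mono_neutral_cong_left) auto
    also have "\<dots> = (\<Sum>h\<in>H. fscale (?c h) (z h))"
      by (subst sum.reindex[OF inj]) simp
    finally have "(\<Sum>h\<in>H. fscale (?c h) (z h)) \<in> ?R"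
      using F by simp
    then have "coord_at (I h) (\<alpha> h) (\<Sum>h\<in>H. fscale (?c h) (z h)) = 0"
      by (rule coord_at_ws_rel)
    then show "c x = 0" using coord_at_comb[OF h(1), of ?c] diag[OF h(1)] h \<open>x \<in> F\<close> by simp
  next
    fix x assume "x \<in> z ` H"
    then show "x \<in> homogeneous v n ?R (d x)" using hom d by auto
  qed
  then have "ch v n (K, ?R) = (\<Sum>x\<in>z ` H. monom (d x))"
    using fin by (intro ch_eqI[OF K(1)]) auto
  also have "\<dots> = (\<Sum>h\<in>H. monom (deg h))"
    unfolding sum.reindex[OF inj] by (intro sum.cong) (simp_all add: d)
  finally show ?thesis .
qed

text \<open>The powers \<open>v\<^sub>i\<^sup>m\<close> are themselves basis elements \<open>v\<^sub>I \<otimes> v\<^sup>\<alpha>\<close>, with \<open>I\<close> empty; they are distinct since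
  \<open>m > 0\<close>.\<close>

lemma ch_power_span:
  assumes "m \<ge> 1"
  shows "ch v n (power_span scale v n m) = (\<Sum>i = 1..n. monom (Poly_Mapping.single i m))"
proof -
  let ?R = "ws_rel scale 0 m" and ?z = "\<lambda>i. gen [] (replicate m (v i)) :: ('v, 'k) ws"
  define K where "K = free.span ({?z i | i. i \<in> {1..n}} \<union> ?R)"
  have K: "free.subspace K" "?R \<subseteq> K" "\<And>i. i \<in> {1..n} \<Longrightarrow> ?z i \<in> K"
    unfolding K_def by (auto intro: free.span_base)
  have z: "?z i = basis_elt v n {} (Poly_Mapping.single i m)" if "i \<in> {1..n}" for i
  proof -
    have "word n (Poly_Mapping.single i m) = replicate m i"
      using word_weight[of "replicate m i" n] that
      by (simp add: weight_replicate sorted_sort_id set_replicate_conv_if)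
    then show ?thesis by (simp add: basis_elt_word)
  qed
  have tensor_index: "({}, Poly_Mapping.single i m) \<in> tensor_index 0 m" if "i \<in> {1..n}" for i
    using that weight_exps[of "replicate m i" "{1..n}"]
    by (simp add: tensor_index_def weight_replicate set_replicate_conv_if)
  have single: "Poly_Mapping.single i m = Poly_Mapping.single j m \<longleftrightarrow> i = j" for i j :: nat
    using assms by (metis lookup_single_eq lookup_single_not_eq not_one_le_zero)
  have coord_at: "coord_at {} (Poly_Mapping.single i m) (?z j) = (if i = j then 1 else 0)"
    if "i \<in> {1..n}" "j \<in> {1..n}" for i j
    using coord_at_index[OF tensor_index tensor_index] that by (simp add: z single del: One_nat_def)
  have "ch v n (K, ?R) = (\<Sum>i = 1..n. monom (Poly_Mapping.single i m))"
  proof (rule ch_eq_dual_family[where z = ?z and I = "\<lambda>_. {}" and \<alpha> = "\<lambda>i. Poly_Mapping.single i m"])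
    show "K \<subseteq> ws_free 0 m"
      unfolding K_def using ws_rel_subset_ws_free
      by (intro free.span_minimal subspace_ws_free) (auto intro: gen_in_ws_free)
    show "?z i \<in> homogeneous v n ?R (Poly_Mapping.single i m)" if "i \<in> {1..n}" for i
      unfolding z[OF that] homogeneous_def
    proof (rule free.span_base, rule UnI1, rule CollectI, intro exI conjI)
      show "basis_elt v n {} (Poly_Mapping.single i m) = basis_elt v n {} (Poly_Mapping.single i m)" ..
      show "Poly_Mapping.keys (Poly_Mapping.single i m) \<subseteq> {1..n}"
        using tensor_indexD(4)[OF tensor_index[OF that]] .
    qed (simp_all add: mdeg_def)
    fix x assume x: "x \<in> K" "\<And>i. i \<in> {1..n} \<Longrightarrow> coord_at {} (Poly_Mapping.single i m) x = 0"
    have "{?z i | i. i \<in> {1..n}} = ?z ` {1..n}" by auto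
    then obtain y r where yr: "x = y + r" "y \<in> free.span (?z ` {1..n})" "r \<in> ?R"
      using x(1) unfolding K_def free.span_Un free.span_eq_iff[THEN iffD2, OF subspace_ws_rel]
      by auto
    have "y - (\<Sum>i = 1..n. fscale (coord_at {} (Poly_Mapping.single i m) y) (?z i)) = 0"
      using yr(2)
    proof (induction rule: free.span_induct_alt)
      case (step c u w)
      then obtain j where j: "j \<in> {1..n}" "u = ?z j" by blast
      have "(\<Sum>i = 1..n. fscale (coord_at {} (Poly_Mapping.single i m) u) (?z i))
          = (\<Sum>i = 1..n. if i = j then u else 0)"
        using j by (intro sum.cong) (auto simp: coord_at simp del: One_nat_def)
      also have "\<dots> = u" using j by simp
      finally have u: "(\<Sum>i = 1..n. fscale (coord_at {} (Poly_Mapping.single i m) u) (?z i)) = u" .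
      have "(\<Sum>i = 1..n. fscale (coord_at {} (Poly_Mapping.single i m) (fscale c u + w)) (?z i))
        = fscale c (\<Sum>i = 1..n. fscale (coord_at {} (Poly_Mapping.single i m) u) (?z i))
          + (\<Sum>i = 1..n. fscale (coord_at {} (Poly_Mapping.single i m) w) (?z i))"
        by (simp add: coord_at_add coord_at_fscale free.scale_left_distrib sum.distrib free.scale_sum_right)
      then show ?case using step(2) by (simp add: u del: One_nat_def)
    qed simp
    moreover have "coord_at {} (Poly_Mapping.single i m) y = 0" if "i \<in> {1..n}" for i
      using x(2)[OF that] yr by (simp add: coord_at_add coord_at_ws_rel)
    ultimately have "y = 0" by simp
    then show "x \<in> ?R" using yr by simp
  qed (use K coord_at in \<open>auto simp del: One_nat_def\<close>)
  then show ?thesis by (simp add: power_span_def K_def)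
qed

end

section \<open>Hooks\<close>

text \<open>A triple \<open>(c, J, \<gamma>)\<close> encodes a semistandard tableau of hook shape by its corner \<open>c\<close>, the set \<open>J\<close> of the
  \<open>b\<close> entries below the corner, and the content \<open>\<gamma>\<close> of the \<open>k\<close> cells to the right of it. It also names
  the boundary of the face \<open>J \<union> {c}\<close> that has the least variable \<open>c\<close> as a vertex.\<close>

definition hooks :: "nat \<Rightarrow> nat \<Rightarrow> nat \<Rightarrow> (nat \<times> nat set \<times> monomial) set" where
  "hooks n k b = {(c, J, \<gamma>). c \<in> {1..n} \<and> J \<subseteq> {c<..n} \<and> card J = b \<and> \<gamma> \<in> exps {c..n} k}"

definition hook_deg :: "nat \<times> nat set \<times> monomial \<Rightarrow> monomial" where
  "hook_deg = (\<lambda>(c, J, \<gamma>). mdeg (insert c J) \<gamma>)"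

lemma finite_hooks: "finite (hooks n k b)"
proof (rule finite_subset)
  show "hooks n k b \<subseteq> {1..n} \<times> Pow {1..n} \<times> exps {1..n} k"
  proof
    fix h assume "h \<in> hooks n k b"
    moreover obtain c J \<gamma> where "h = (c, J, \<gamma>)" by (cases h)
    ultimately show "h \<in> {1..n} \<times> Pow {1..n} \<times> exps {1..n} k"
      using exps_subset_iff[of "{c..n}" "{1..n}" \<gamma> k] by (auto simp: hooks_def)
  qed
qed (simp add: finite_exps)

text \<open>The inequalities in \<open>hooks\<close> together say that \<open>c\<close> is the least variable of the total multidegree. In this
  form a triple can be recovered from its multidegree and \<open>J\<close>.\<close>

lemma hooks_iff:
  "(c, J, \<gamma>) \<in> hooks n k b \<longleftrightarrow> c \<in> {1..n} \<and> c \<notin> J \<and> finite J \<and> card J = b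
     \<and> mdeg (insert c J) \<gamma> \<in> exps {1..n} (Suc b + k)
     \<and> (\<forall>j\<in>Poly_Mapping.keys (mdeg (insert c J) \<gamma>). c \<le> j)"
proof (cases "c \<in> {1..n} \<and> c \<notin> J \<and> finite J \<and> card J = b")
  case True
  then have sub: "insert c J \<subseteq> {1..n}" if "mdeg (insert c J) \<gamma> \<in> exps {1..n} (Suc b + k)"
    using that keys_mdeg[of "insert c J" \<gamma>] by (simp add: exps_def)
  have deg: "mdeg (insert c J) \<gamma> \<in> exps {1..n} (Suc b + k) \<longleftrightarrow> \<gamma> \<in> exps {1..n} k"
    if "insert c J \<subseteq> {1..n}"
    using mdeg_in_exps_iff[OF _ that] True by simp
  have arm: "\<gamma> \<in> exps {c..n} k \<longleftrightarrow> \<gamma> \<in> exps {1..n} k \<and> Poly_Mapping.keys \<gamma> \<subseteq> {c..n}"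
    using True by (intro exps_subset_iff) auto
  have "J \<subseteq> {c<..n} \<and> \<gamma> \<in> exps {c..n} k \<longleftrightarrow> mdeg (insert c J) \<gamma> \<in> exps {1..n} (Suc b + k)
      \<and> (\<forall>j\<in>Poly_Mapping.keys (mdeg (insert c J) \<gamma>). c \<le> j)" (is "?L \<longleftrightarrow> ?R")
  proof
    assume ?L
    moreover from this have "insert c J \<subseteq> {1..n}" using True by auto
    ultimately show ?R using True deg arm keys_mdeg[of "insert c J" \<gamma>] by auto
  next
    assume R: ?R
    then have "insert c J \<subseteq> {1..n}" using sub by blast
    moreover have "\<forall>j\<in>J. c < j"
      using R True keys_mdeg[of "insert c J" \<gamma>] by (metis UnCI finite_insert insertCI le_neq_implies_less)
    moreover have "\<forall>j\<in>Poly_Mapping.keys \<gamma>. c \<le> j"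
      using R True keys_mdeg[of "insert c J" \<gamma>] by auto
    ultimately show ?L
      using R deg arm by (auto simp: exps_def)
  qed
  then show ?thesis using True by (auto simp: hooks_def)
next
  case False
  then show ?thesis by (auto simp: hooks_def intro: finite_subset)
qed

section \<open>The kernel of the Koszul map\<close>

context based_space
begin

lemma wedge_coord_snoc_basis_elt:
  assumes "J \<subseteq> {1..n}" "C \<subseteq> {1..n}" "i \<in> {1..n}" "Poly_Mapping.keys \<gamma> \<subseteq> {1..n}"
  obtains \<epsilon> where "wedge_coord (sorted_list_of_set J @ [i]) (basis_elt v n C \<gamma>) = Poly_Mapping.single \<gamma> \<epsilon>"
    and "\<epsilon> \<noteq> 0 \<longleftrightarrow> i \<notin> J \<and> insert i J = C"
proof -
  have fin: "finite J" using assms by (auto intro: finite_subset)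
  show ?thesis
  proof (cases "i \<in> J")
    case True
    then have "wedge_coord (sorted_list_of_set J @ [i]) (basis_elt v n C \<gamma>) = 0"
      using fin by (intro wedge_coord_not_distinct) simp
    then show ?thesis using that[of 0] True by simp
  next
    case False
    then have "distinct (sorted_list_of_set J @ [i])" using fin by simp
    from wedge_coord_sort[OF this] obtain \<epsilon> where \<epsilon>: "\<epsilon> \<noteq> 0"
      "\<And>x. wedge_coord (sorted_list_of_set J @ [i]) x = fscale \<epsilon> (wedge_coord (sorted_list_of_set (insert i J)) x)"
      using fin by (auto simp del: distinct_append)
    have "wedge_coord (sorted_list_of_set (insert i J)) (basis_elt v n C \<gamma>)
        = (if insert i J = C then Poly_Mapping.single \<gamma> 1 else 0)"
      using assms by (intro wedge_coord_basis) auto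
    then have "wedge_coord (sorted_list_of_set J @ [i]) (basis_elt v n C \<gamma>)
        = Poly_Mapping.single \<gamma> (if insert i J = C then \<epsilon> else 0)"
      by (simp add: \<epsilon>(2) fscale_single)
    then show ?thesis using that False \<epsilon>(1) by auto
  qed
qed

text \<open>The image of \<open>v\<^sub>C \<otimes> v\<^sup>\<gamma>\<close> is a sum of terms \<open>v\<^sub>J \<otimes> v\<^sub>i v\<^sup>\<gamma>\<close> with signs, one for each way of writing \<open>C\<close> as
  \<open>J \<union> {i}\<close>, and different terms are multiples of different basis elements.\<close>

lemma coord_at_koszul_basis_elt_nonzero_iff:
  assumes J: "J \<subseteq> {1..n}" and C: "C \<subseteq> {1..n}" and \<gamma>: "Poly_Mapping.keys \<gamma> \<subseteq> {1..n}"
  shows "coord_at J \<beta> (koszul (basis_elt v n C \<gamma>)) \<noteq> 0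
    \<longleftrightarrow> (\<exists>i. i \<notin> J \<and> insert i J = C \<and> \<beta> = Poly_Mapping.single i 1 + \<gamma>)"
proof -
  let ?t = "\<lambda>i. Poly_Mapping.lookup (var i * wedge_coord (sorted_list_of_set J @ [i]) (basis_elt v n C \<gamma>)) \<beta>"
  have sum: "coord_at J \<beta> (koszul (basis_elt v n C \<gamma>)) = (\<Sum>i = 1..n. ?t i)"
    by (simp add: coord_at_def wedge_coord_koszul lookup_sum)
  have t: "?t i \<noteq> 0 \<longleftrightarrow> i \<notin> J \<and> insert i J = C \<and> \<beta> = Poly_Mapping.single i 1 + \<gamma>"
    if i: "i \<in> {1..n}" for i
  proof -
    obtain \<epsilon> where \<epsilon>:
      "wedge_coord (sorted_list_of_set J @ [i]) (basis_elt v n C \<gamma>) = Poly_Mapping.single \<gamma> \<epsilon>"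
      "\<epsilon> \<noteq> 0 \<longleftrightarrow> i \<notin> J \<and> insert i J = C"
      using wedge_coord_snoc_basis_elt[OF J C i \<gamma>] .
    show ?thesis
      unfolding \<epsilon>(1) using \<epsilon>(2)
      by (auto simp: var_def mult_single lookup_single when_def)
  qed
  show ?thesis
  proof
    assume "coord_at J \<beta> (koszul (basis_elt v n C \<gamma>)) \<noteq> 0"
    then obtain i where "i \<in> {1..n}" "?t i \<noteq> 0"
      unfolding sum by (metis (no_types, lifting) sum.neutral)
    then show "\<exists>i. i \<notin> J \<and> insert i J = C \<and> \<beta> = Poly_Mapping.single i 1 + \<gamma>"
      using t by blast
  next
    assume "\<exists>i. i \<notin> J \<and> insert i J = C \<and> \<beta> = Poly_Mapping.single i 1 + \<gamma>"
    then obtain i where i: "i \<notin> J" "insert i J = C" "\<beta> = Poly_Mapping.single i 1 + \<gamma>" by blast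
    have "i \<in> {1..n}" using i C by blast
    moreover have "?t j = 0" if "j \<in> {1..n} - {i}" for j
      using t[of j] that i by blast
    ultimately have "coord_at J \<beta> (koszul (basis_elt v n C \<gamma>)) = ?t i"
      unfolding sum by (subst sum.remove[of _ i]) (auto simp del: One_nat_def)
    then show "coord_at J \<beta> (koszul (basis_elt v n C \<gamma>)) \<noteq> 0"
      using t \<open>i \<in> {1..n}\<close> i by simp
  qed
qed

definition hook_vec :: "nat \<times> nat set \<times> monomial \<Rightarrow> ('v, 'k) ws" where
  "hook_vec = (\<lambda>(c, J, \<gamma>). koszul (basis_elt v n (insert c J) \<gamma>))"

lemma hooksD:
  assumes "(c, J, \<gamma>) \<in> hooks n k b"
  shows "c \<in> {1..n}" "c \<notin> J" "J \<subseteq> {1..n}" "finite J" "Poly_Mapping.keys \<gamma> \<subseteq> {1..n}"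
    "(insert c J, \<gamma>) \<in> tensor_index (Suc b) k"
proof -
  show *: "c \<in> {1..n}" "c \<notin> J" "J \<subseteq> {1..n}"
    using assms by (auto simp: hooks_def subset_iff)
  then show "finite J" by (auto intro: finite_subset)
  moreover have "\<gamma> \<in> exps {1..n} k"
    using assms exps_subset_iff[of "{c..n}" "{1..n}" \<gamma> k] by (auto simp: hooks_def)
  ultimately show "Poly_Mapping.keys \<gamma> \<subseteq> {1..n}" "(insert c J, \<gamma>) \<in> tensor_index (Suc b) k"
    using assms * by (auto simp: tensor_index_def hooks_def exps_def)
qed

text \<open>Among the terms of the boundary of \<open>J' \<union> {c'}\<close>, exactly one avoids the least variable \<open>c'\<close>, namely
  the one with exterior part \<open>J'\<close>. The coordinates at these terms are therefore dual to the boundaries.\<close>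

lemma coord_at_hook_vec:
  assumes h: "(c, J, \<gamma>) \<in> hooks n k b" and h': "(c', J', \<gamma>') \<in> hooks n k b"
  shows "coord_at J (Poly_Mapping.single c 1 + \<gamma>) (hook_vec (c', J', \<gamma>')) \<noteq> 0
    \<longleftrightarrow> (c, J, \<gamma>) = (c', J', \<gamma>')"
proof -
  note D = hooksD[OF h] and D' = hooksD[OF h']
  have "coord_at J (Poly_Mapping.single c 1 + \<gamma>) (hook_vec (c', J', \<gamma>')) \<noteq> 0
    \<longleftrightarrow> (\<exists>i. i \<notin> J \<and> insert i J = insert c' J' \<and>
      Poly_Mapping.single c 1 + \<gamma> = Poly_Mapping.single i 1 + \<gamma>')"
    using D D' by (simp add: hook_vec_def coord_at_koszul_basis_elt_nonzero_iff)
  also have "\<dots> \<longleftrightarrow> (c, J, \<gamma>) = (c', J', \<gamma>')"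
  proof
    assume "\<exists>i. i \<notin> J \<and> insert i J = insert c' J' \<and>
      Poly_Mapping.single c 1 + \<gamma> = Poly_Mapping.single i 1 + \<gamma>'"
    then obtain i where i: "i \<notin> J" "insert i J = insert c' J'"
      "Poly_Mapping.single c 1 + \<gamma> = Poly_Mapping.single i 1 + \<gamma>'" by blast
    have keys: "Poly_Mapping.keys (Poly_Mapping.single j 1 + \<delta>) = insert j (Poly_Mapping.keys \<delta>)"
      for j and \<delta> :: monomial
      by (auto simp: in_keys_iff lookup_add lookup_single when_def split: if_splits)
    have eq: "insert c (Poly_Mapping.keys \<gamma>) \<union> J = insert c' (Poly_Mapping.keys \<gamma>' \<union> J')"
    proof -
      have "insert c (Poly_Mapping.keys \<gamma>) = insert i (Poly_Mapping.keys \<gamma>')"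
        using i(3) keys by metis
      then show ?thesis using i(2) by blast
    qed
    have le: "\<forall>j \<in> insert c (Poly_Mapping.keys \<gamma>) \<union> J. c \<le> j"
      "\<forall>j \<in> insert c' (Poly_Mapping.keys \<gamma>' \<union> J'). c' \<le> j"
      using h h' by (auto simp: hooks_def exps_def subset_iff less_imp_le)
    have "c = c'"
    proof (rule antisym)
      have "c' \<in> insert c (Poly_Mapping.keys \<gamma>) \<union> J" unfolding eq by simp
      then show "c \<le> c'" using le(1) by blast
      have "c \<in> insert c' (Poly_Mapping.keys \<gamma>' \<union> J')" using eq by blast
      then show "c' \<le> c" using le(2) by blast
    qed
    moreover have "i = c'"
    proof -
      have "c' \<in> insert i J" unfolding i(2) by simp
      then show ?thesis using \<open>c = c'\<close> D(2) by blast
    qed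
    ultimately show "(c, J, \<gamma>) = (c', J', \<gamma>')"
      using i D(2) D'(2) by (auto dest: insert_ident)
  next
    assume "(c, J, \<gamma>) = (c', J', \<gamma>')"
    then show "\<exists>i. i \<notin> J \<and> insert i J = insert c' J' \<and>
      Poly_Mapping.single c 1 + \<gamma> = Poly_Mapping.single i 1 + \<gamma>'"
      using D(2) by (intro exI[of _ c]) simp
  qed
  finally show ?thesis .
qed

lemma koszul_ws_rel:
  assumes "x \<in> ws_rel scale (Suc b) a"
  shows "koszul x \<in> ws_rel scale b (Suc a)"
proof -
  have "koszul x \<in> ws_free b (Suc a)"
    using assms ws_rel_subset_ws_free by (intro koszul_ws_free) auto
  then show ?thesis
    using assms by (auto simp: ws_rel_iff_coord_at coord_at_def wedge_coord_koszul wedge_coord_ws_rel)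
qed

lemma koszul_koszul:
  assumes "x \<in> ws_free (Suc (Suc b)) a"
  shows "koszul (koszul x) \<in> ws_rel scale b (Suc (Suc a))"
  using assms koszul_ws_free[OF koszul_ws_free[OF assms]]
  by (auto simp: ws_rel_iff_coord_at coord_at_def wedge_coord_koszul_koszul)

text \<open>A cycle \<open>x\<close> is determined by its coordinates at the \<open>v\<^sub>I \<otimes> v\<^sup>\<beta>\<close> for which \<open>I\<close> does not contain the least
  variable \<open>c\<close> of the multidegree. If \<open>I = J \<union> {c}\<close>, then the coordinate of \<open>koszul x\<close> at
  \<open>v\<^sub>J \<otimes> v\<^sub>c v\<^sup>\<beta>\<close> is, up to signs, the coordinate of \<open>x\<close> at \<open>v\<^sub>I \<otimes> v\<^sup>\<beta>\<close> plus coordinates at sets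
  \<open>J \<union> {i}\<close> without \<open>c\<close>. This is the cone argument for the exactness of the complex.\<close>

lemma kernel_faithful:
  assumes x: "x \<in> ws_free b (Suc k)"
    and ker: "koszul x \<in> ws_rel scale (b - 1) (Suc (Suc k))"
    and zero: "\<And>c J \<gamma>. (c, J, \<gamma>) \<in> hooks n k b \<Longrightarrow> coord_at J (Poly_Mapping.single c 1 + \<gamma>) x = 0"
  shows "x \<in> ws_rel scale b (Suc k)"
proof -
  have no_min: "coord_at I \<beta> x = 0"
    if I: "(I, \<beta>) \<in> tensor_index b (Suc k)" and c: "c \<notin> I" "c \<in> Poly_Mapping.keys \<beta>"
      and min: "\<forall>j \<in> I \<union> Poly_Mapping.keys \<beta>. c \<le> j" for I \<beta> c
  proof -
    obtain \<gamma> where \<gamma>: "\<beta> = Poly_Mapping.single c 1 + \<gamma>"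
      using c(2) split_off_single[of \<beta> c] by (auto simp: in_keys_iff)
    note D = tensor_indexD[OF I]
    have mdeg: "mdeg (insert c I) \<gamma> = mdeg I \<beta>"
      using mdeg_insert[OF D(2) c(1)] by (simp add: \<gamma>)
    have "mdeg I \<beta> \<in> exps {1..n} (Suc b + k)"
      using mdeg_in_exps_iff[of "{1..n}" I \<beta> "Suc k"] D by simp
    then have "(c, I, \<gamma>) \<in> hooks n k b"
      unfolding hooks_iff mdeg keys_mdeg[OF D(2)] using D c min by auto
    then show ?thesis using zero \<gamma> by blast
  qed
  have "coord_at I \<beta> x = 0" if I: "(I, \<beta>) \<in> tensor_index b (Suc k)" for I \<beta>
  proof -
    note D = tensor_indexD[OF I]
    let ?U = "I \<union> Poly_Mapping.keys \<beta>"
    have "\<beta> \<noteq> 0" using D(5) by (auto simp: exps_def)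
    then have U: "finite ?U" "?U \<noteq> {}" using D(2) by auto
    define c where "c = Min ?U"
    have c: "c \<in> ?U" "\<forall>j\<in>?U. c \<le> j"
      unfolding c_def using Min_in[OF U] Min_le[OF U(1)] by blast+
    show ?thesis
    proof (cases "c \<in> I")
      case False
      then show ?thesis using no_min[OF I False] c by blast
    next
      case True
      define J where "J = I - {c}"
      have J: "I = insert c J" "c \<notin> J" "finite J" using True D(2) by (auto simp: J_def)
      then obtain b' where b': "b = Suc b'" using D(3) by (cases b) auto
      have "c \<in> {1..n}" using True D(1) by blast
      let ?\<beta> = "Poly_Mapping.single c 1 + \<beta>"
      let ?t = "\<lambda>i. Poly_Mapping.lookup (var i * wedge_coord (sorted_list_of_set J @ [i]) x) ?\<beta>"
      have snoc: "\<exists>\<epsilon>. \<epsilon> \<noteq> 0 \<and> wedge_coord (sorted_list_of_set J @ [i]) x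
          = fscale \<epsilon> (wedge_coord (sorted_list_of_set (insert i J)) x)" if "i \<notin> J" for i
      proof -
        have set: "set (sorted_list_of_set J @ [i]) = insert i J" using J(3) by simp
        have "distinct (sorted_list_of_set J @ [i])" using that J(3) by simp
        then show ?thesis by (rule wedge_coord_sort) (unfold set, blast)
      qed
      \<comment> \<open>A term with another variable \<open>i\<close> refers to the set \<open>J \<union> {i}\<close>, which misses \<open>c\<close>, in the same multidegree.\<close>
      have other: "?t i = 0" if i: "i \<in> {1..n} - {c}" for i
      proof (cases "i \<in> J \<or> Poly_Mapping.lookup \<beta> i = 0")
        case True
        then show ?thesis
        proof
          assume "i \<in> J"
          then have "wedge_coord (sorted_list_of_set J @ [i]) x = 0"
            using J(3) by (intro wedge_coord_not_distinct) simp
          then show ?thesis by simp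
        next
          assume "Poly_Mapping.lookup \<beta> i = 0"
          then show ?thesis
            using i by (intro lookup_var_mult_eq_0) (auto simp: lookup_add lookup_single when_def)
        qed
      next
        case False
        then have "i \<notin> J" "i \<in> Poly_Mapping.keys \<beta>" by (auto simp: in_keys_iff)
        obtain \<delta> where \<delta>: "\<beta> = Poly_Mapping.single i 1 + \<delta>"
          using False split_off_single[of \<beta> i] by auto
        obtain \<epsilon> where "wedge_coord (sorted_list_of_set J @ [i]) x
            = fscale \<epsilon> (wedge_coord (sorted_list_of_set (insert i J)) x)"
          using snoc[OF \<open>i \<notin> J\<close>] by blast
        moreover have "?\<beta> = Poly_Mapping.single i 1 + (Poly_Mapping.single c 1 + \<delta>)"
          by (simp add: \<delta> ac_simps)
        ultimately have "?t i = \<epsilon> * coord_at (insert i J) (Poly_Mapping.single c 1 + \<delta>) x"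
          by (simp add: lookup_var_mult coord_at_def del: One_nat_def)
        also have "coord_at (insert i J) (Poly_Mapping.single c 1 + \<delta>) x = 0"
        proof (rule no_min[of _ _ c])
          have "\<delta> \<in> exps {1..n} k"
            using D(5) by (simp add: \<delta> exps_single_add_iff del: One_nat_def)
          then show "(insert i J, Poly_Mapping.single c 1 + \<delta>) \<in> tensor_index b (Suc k)"
            using i J D \<open>c \<in> {1..n}\<close> \<open>i \<notin> J\<close> by (auto simp: tensor_index_def exps_single_add_iff simp del: One_nat_def)
          show "c \<notin> insert i J" using i J by blast
          show "c \<in> Poly_Mapping.keys (Poly_Mapping.single c 1 + \<delta>)"
            by (simp add: in_keys_iff lookup_add)
          show "\<forall>j\<in>insert i J \<union> Poly_Mapping.keys (Poly_Mapping.single c 1 + \<delta>). c \<le> j"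
          proof
            fix j assume "j \<in> insert i J \<union> Poly_Mapping.keys (Poly_Mapping.single c 1 + \<delta>)"
            then have "j \<in> ?U \<or> j = c"
              using \<open>i \<in> Poly_Mapping.keys \<beta>\<close> J(1)
              by (auto simp: \<delta> in_keys_iff lookup_add lookup_single when_def split: if_splits)
            then show "c \<le> j" using c(2) by blast
          qed
        qed
        finally show ?thesis by simp
      qed
      obtain \<epsilon> where \<epsilon>: "\<epsilon> \<noteq> 0" "wedge_coord (sorted_list_of_set J @ [c]) x = fscale \<epsilon> (wedge_coord (sorted_list_of_set I) x)"
        using snoc[OF J(2)] J(1) by auto
      have "0 = Poly_Mapping.lookup (wedge_coord (sorted_list_of_set J) (koszul x)) ?\<beta>"
        using ker by (simp add: wedge_coord_ws_rel)
      also have "\<dots> = (\<Sum>i = 1..n. ?t i)"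
        by (simp add: wedge_coord_koszul lookup_sum)
      also have "\<dots> = ?t c"
        using \<open>c \<in> {1..n}\<close> other by (subst sum.remove[of _ c]) (auto simp del: One_nat_def)
      also have "\<dots> = \<epsilon> * coord_at I \<beta> x"
        by (simp add: \<epsilon>(2) lookup_var_mult coord_at_def del: One_nat_def)
      finally show ?thesis using \<epsilon>(1) by simp
    qed
  qed
  then show ?thesis using x by (auto simp: ws_rel_iff_coord_at)
qed

text \<open>The boundaries \<open>hook_vec\<close> lie in the kernel because the Koszul map has square zero. The coordinates at
  the terms without the least variable are dual to them by \<open>coord_at_hook_vec\<close> and determine the
  elements of the kernel by \<open>kernel_faithful\<close>.\<close>

lemma ch_hook_schur:
  "ch v n (hook_schur scale (Suc k) b) = (\<Sum>h\<in>hooks n k b. monom (hook_deg h))"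
proof -
  let ?R = "ws_rel scale b (Suc k)" and ?R' = "ws_rel scale (b - 1) (Suc k + 1)"
  define K where "K = {x \<in> ws_free b (Suc k). koszul x \<in> ?R'}"
  have "ch v n (K, ?R) = (\<Sum>h\<in>hooks n k b. monom (hook_deg h))"
  proof (rule ch_eq_dual_family[where z = hook_vec and I = "\<lambda>(c, J, \<gamma>). J"
        and \<alpha> = "\<lambda>(c, J, \<gamma>). Poly_Mapping.single c 1 + \<gamma>"])
    show KF: "K \<subseteq> ws_free b (Suc k)" by (auto simp: K_def)
    show "free.subspace K"
      using subspace_ws_free[of b "Suc k"] subspace_ws_rel[of scale "b - 1" "Suc k + 1"]
      by (auto simp: K_def free.subspace_def koszul_add koszul_fscale)
    show "?R \<subseteq> K"
    proof
      fix x assume x: "x \<in> ?R"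
      then have "x \<in> ws_free b (Suc k)" using ws_rel_subset_ws_free by blast
      moreover from this have "koszul x \<in> ?R'"
        using x koszul_ws_rel[of x _ "Suc k"] koszul_ws_free_0[of x "Suc k"]
        by (cases b) (auto simp: free.subspace_0[OF subspace_ws_rel])
      ultimately show "x \<in> K" by (simp add: K_def)
    qed
    show zK: "hook_vec h \<in> K" if "h \<in> hooks n k b" for h
    proof -
      obtain c J \<gamma> where h: "h = (c, J, \<gamma>)" by (cases h)
      let ?e = "basis_elt v n (insert c J) \<gamma> :: ('v, 'k) ws"
      have e: "?e \<in> ws_free (Suc b) k"
        using that hooksD(6) unfolding h by (intro basis_elt_in_ws_free)
      then have z: "koszul ?e \<in> ws_free b (Suc k)" by (rule koszul_ws_free)
      have "koszul (koszul ?e) \<in> ?R'"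
      proof (cases b)
        case 0
        then have "koszul (koszul ?e) = 0" using z koszul_ws_free_0 by blast
        then show ?thesis by (simp add: free.subspace_0[OF subspace_ws_rel])
      next
        case (Suc b')
        then show ?thesis using koszul_koszul[of ?e b' k] e by simp
      qed
      with z show ?thesis by (simp add: K_def h hook_vec_def)
    qed
    show "hook_vec h \<in> homogeneous v n ?R (hook_deg h)" if h: "h \<in> hooks n k b" for h
    proof (rule homogeneousI)
      show "hook_vec h \<in> ws_free b (Suc k)" using zK[OF h] KF by blast
      obtain c J \<gamma> where hh: "h = (c, J, \<gamma>)" by (cases h)
      fix I \<beta> assume I: "(I, \<beta>) \<in> tensor_index b (Suc k)" "coord_at I \<beta> (hook_vec h) \<noteq> 0"
      then obtain i where "i \<notin> I" "insert i I = insert c J" "\<beta> = Poly_Mapping.single i 1 + \<gamma>"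
        using hooksD[OF h[unfolded hh]] tensor_indexD[OF I(1)]
        by (auto simp: hh hook_vec_def coord_at_koszul_basis_elt_nonzero_iff)
      then show "mdeg I \<beta> = hook_deg h"
        using mdeg_insert[of I i \<gamma>] tensor_indexD(2)[OF I(1)] by (simp add: hh hook_deg_def)
    qed
    show "coord_at (case h of (c, J, \<gamma>) \<Rightarrow> J) (case h of (c, J, \<gamma>) \<Rightarrow> Poly_Mapping.single c 1 + \<gamma>) (hook_vec h) \<noteq> 0"
      if "h \<in> hooks n k b" for h
    proof -
      obtain c J \<gamma> where "h = (c, J, \<gamma>)" by (cases h)
      then show ?thesis
        using that coord_at_hook_vec[of c J \<gamma> k b c J \<gamma>] by (simp del: One_nat_def)
    qed
    show "coord_at (case h of (c, J, \<gamma>) \<Rightarrow> J) (case h of (c, J, \<gamma>) \<Rightarrow> Poly_Mapping.single c 1 + \<gamma>) (hook_vec h') = 0"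
      if "h \<in> hooks n k b" "h' \<in> hooks n k b" "h \<noteq> h'" for h h'
    proof -
      obtain c J \<gamma> c' J' \<gamma>' where hh: "h = (c, J, \<gamma>)" "h' = (c', J', \<gamma>')"
        by (cases h; cases h')
      then show ?thesis
        using that coord_at_hook_vec[of c J \<gamma> k b c' J' \<gamma>'] by (auto simp del: One_nat_def)
    qed
    fix x
    assume x: "x \<in> K" and zero: "\<And>h. h \<in> hooks n k b \<Longrightarrow>
        coord_at (case h of (c, J, \<gamma>) \<Rightarrow> J) (case h of (c, J, \<gamma>) \<Rightarrow> Poly_Mapping.single c 1 + \<gamma>) x = 0"
    show "x \<in> ?R"
    proof (rule kernel_faithful)
      show "x \<in> ws_free b (Suc k)" "koszul x \<in> ws_rel scale (b - 1) (Suc (Suc k))"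
        using x by (simp_all add: K_def)
      fix c J \<gamma> assume "(c, J, \<gamma>) \<in> hooks n k b"
      from zero[OF this] show "coord_at J (Poly_Mapping.single c 1 + \<gamma>) x = 0" by (simp only: prod.case)
    qed
  qed (rule finite_hooks)
  then show ?thesis by (simp add: hook_schur_def K_def)
qed

end

section \<open>Tableaux of hook shape\<close>

lemma cells_hook: "cells (Suc k # replicate b 1) = Pair 0 ` {..k} \<union> (\<lambda>i. (i, 0)) ` {1..b}"
  by (auto simp: cells_def nth_Cons split: nat.splits)

lemmas cells_hook_simps = cells_hook[unfolded One_nat_def] cells_hook

definition hook_tableau :: "nat \<Rightarrow> nat \<Rightarrow> nat \<Rightarrow> nat \<times> nat set \<times> monomial \<Rightarrow> nat \<times> nat \<Rightarrow> nat" where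
  "hook_tableau n k b = (\<lambda>(c, J, \<gamma>). \<lambda>(i, j)\<in>cells (Suc k # replicate b 1).
     if i = 0 then (c # word n \<gamma>) ! j else (c # sorted_list_of_set J) ! i)"

definition tableau_hook :: "nat \<Rightarrow> nat \<Rightarrow> (nat \<times> nat \<Rightarrow> nat) \<Rightarrow> nat \<times> nat set \<times> monomial" where
  "tableau_hook k b T =
     (T (0, 0), (\<lambda>i. T (i, 0)) ` {1..b}, weight (map (\<lambda>j. T (0, j)) [1..<Suc k]))"

lemma hook_tableau_ssyt:
  assumes h: "(c, J, \<gamma>) \<in> hooks n k b"
  shows "hook_tableau n k b (c, J, \<gamma>) \<in> ssyt n (Suc k # replicate b 1)"
    and "tableau_hook k b (hook_tableau n k b (c, J, \<gamma>)) = (c, J, \<gamma>)"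
proof -
  let ?T = "hook_tableau n k b (c, J, \<gamma>)"
  have D: "c \<in> {1..n}" "J \<subseteq> {c<..n}" "card J = b" "finite J"
    "\<gamma> \<in> exps {1..n} k" "Poly_Mapping.keys \<gamma> \<subseteq> {c..n}"
    using h exps_subset_iff[of "{c..n}" "{1..n}" \<gamma> k] by (auto simp: hooks_def intro: finite_subset)
  let ?row = "c # word n \<gamma>" and ?col = "c # sorted_list_of_set J"
  have row: "length ?row = Suc k" "set ?row \<subseteq> {1..n}" "sorted ?row"
    using D sorted_word[of n \<gamma>] by (auto simp: length_word exps_def set_word)
  have col: "length ?col = Suc b" "set ?col \<subseteq> {1..n}" "sorted_wrt (<) ?col"
    using D by (auto simp: strict_sorted_iff)
  have T_row: "?T (0, j) = ?row ! j" if "j \<le> k" for j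
    using that by (simp add: hook_tableau_def cells_hook_simps del: One_nat_def)
  have T_col: "?T (i, 0) = ?col ! i" if "i \<le> b" for i
    using that by (cases i) (auto simp: hook_tableau_def cells_hook_simps)
  show "?T \<in> ssyt n (Suc k # replicate b 1)"
    unfolding ssyt_def
  proof (intro CollectI conjI allI impI PiE_I)
    fix p assume "p \<in> cells (Suc k # replicate b 1)"
    then show "?T p \<in> {1..n}"
      unfolding cells_hook
    proof (elim UnE imageE)
      fix j assume "p = (0, j)" "j \<in> {..k}"
      then show ?thesis using T_row[of j] row nth_mem[of j ?row] by (auto simp del: nth_Cons_pos)
    next
      fix i assume "p = (i, 0)" "i \<in> {1..b}"
      then show ?thesis using T_col[of i] col nth_mem[of i ?col] by (auto simp del: nth_Cons_pos)
    qed
  next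
    fix p assume "p \<notin> cells (Suc k # replicate b 1)"
    then show "?T p = undefined" by (simp add: hook_tableau_def)
  next
    fix i j j' assume *: "j < j' \<and> (i, j') \<in> cells (Suc k # replicate b 1)"
    then have "i = 0" "j' \<le> k" by (auto simp: cells_hook_simps)
    then show "?T (i, j) \<le> ?T (i, j')"
      using * row T_row sorted_nth_mono[OF row(3), of j j'] by simp
  next
    fix i i' j assume *: "i < i' \<and> (i', j) \<in> cells (Suc k # replicate b 1)"
    then have "j = 0" "i' \<le> b" by (auto simp: cells_hook_simps)
    then show "?T (i, j) < ?T (i', j)"
      using * col T_col sorted_wrt_nth_less[OF col(3), of i i'] by simp
  qed
  have "(\<lambda>i. ?T (i, 0)) ` {1..b} = (\<lambda>i. sorted_list_of_set J ! (i - 1)) ` {1..b}"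
    by (intro image_cong) (auto simp: T_col nth_Cons')
  also have "\<dots> = (\<lambda>i. sorted_list_of_set J ! i) ` {0..<b}"
  proof -
    have eq: "{1..b} = Suc ` {0..<b}"
      by (simp add: image_Suc_atLeastLessThan atLeastLessThanSuc_atLeastAtMost)
    show ?thesis by (simp only: eq image_image diff_Suc_1)
  qed
  also have "\<dots> = J" using D nth_image[of b "sorted_list_of_set J"] by simp
  finally have J: "(\<lambda>i. ?T (i, 0)) ` {1..b} = J" .
  have "map (\<lambda>j. ?T (0, j)) [1..<Suc k] = word n \<gamma>"
    using row(1) T_row by (intro nth_equalityI) (auto simp del: upt_Suc)
  then show "tableau_hook k b ?T = (c, J, \<gamma>)"
    using D J T_row[of 0] exps_def by (simp add: tableau_hook_def weight_word exps_def)
qed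

text \<open>A strictly increasing column is determined by its set of entries and a weakly increasing row by its
  content, so \<open>tableau_hook\<close> loses no information.\<close>

lemma ssyt_hook:
  assumes T: "T \<in> ssyt n (Suc k # replicate b 1)"
  shows "tableau_hook k b T \<in> hooks n k b" "hook_tableau n k b (tableau_hook k b T) = T"
    and "(\<Sum>p\<in>cells (Suc k # replicate b 1). Poly_Mapping.single (T p) 1) = hook_deg (tableau_hook k b T)"
proof -
  let ?cells = "cells (Suc k # replicate b 1)"
  have T_ext: "T \<in> ?cells \<rightarrow>\<^sub>E {1..n}" using T by (simp add: ssyt_def)
  have T_row: "T (0, j) \<le> T (0, j')" if "j \<le> j'" "j' \<le> k" for j j'
    using T that by (cases "j = j'") (auto simp: ssyt_def cells_hook_simps)
  have T_col: "T (i, 0) < T (i', 0)" if "i < i'" "i' \<le> b" for i i'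
    using T that by (auto simp: ssyt_def cells_hook_simps)
  have T_n: "T (0, j) \<in> {1..n}" if "j \<le> k" for j
    using PiE_mem[OF T_ext, of "(0, j)"] that by (simp add: cells_hook_simps)
  have T_n': "T (i, 0) \<in> {1..n}" if "i \<le> b" for i
    using PiE_mem[OF T_ext, of "(i, 0)"] that by (cases i) (auto simp: cells_hook_simps)
  let ?arm = "map (\<lambda>j. T (0, j)) [1..<Suc k]" and ?leg = "map (\<lambda>i. T (i, 0)) [1..<Suc b]"
  let ?J = "(\<lambda>i. T (i, 0)) ` {1..b}"
  have arm: "sorted ?arm" "set ?arm \<subseteq> {T (0, 0)..n}" "length ?arm = k"
    using T_row T_n by (auto simp: sorted_iff_nth_mono simp del: upt_Suc)
  have leg: "sorted_wrt (<) ?leg" "set ?leg = ?J"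
    using T_col by (auto simp: sorted_wrt_iff_nth_less simp del: upt_Suc)
  have J: "?J \<subseteq> {T (0, 0)<..n}" using T_col[of 0] T_n' by auto
  have inj: "inj_on (\<lambda>i. T (i, 0)) {1..b}"
    using T_col by (intro inj_onI) (metis atLeastAtMost_iff less_irrefl linorder_neqE_nat)
  have c: "T (0, 0) \<in> {1..n}" using T_n by blast
  show hook: "tableau_hook k b T \<in> hooks n k b"
    using weight_exps[OF arm(2)] c J card_image[OF inj] arm(3)
    by (simp add: tableau_hook_def hooks_def del: upt_Suc)
  have w: "word n (weight ?arm) = ?arm"
    using arm c by (subst word_weight) (auto simp: sorted_sort_id simp del: upt_Suc)
  have l: "sorted_list_of_set ?J = ?leg"
    using leg by (metis sorted_list_of_set.idem_if_sorted_distinct strict_sorted_iff)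
  show "hook_tableau n k b (tableau_hook k b T) = T"
  proof
    fix p
    show "hook_tableau n k b (tableau_hook k b T) p = T p"
    proof (cases "p \<in> ?cells")
      case True
      then show ?thesis
        unfolding hook_tableau_def tableau_hook_def prod.case w l
        by (auto simp: cells_hook_simps nth_Cons' simp del: upt_Suc)
    next
      case False
      then show ?thesis
        using PiE_arb[OF T_ext] by (simp add: hook_tableau_def tableau_hook_def)
    qed
  qed
  have "(\<Sum>p\<in>?cells. Poly_Mapping.single (T p) 1) = (\<Sum>p\<in>Pair 0 ` {..k}. Poly_Mapping.single (T p) 1)
      + (\<Sum>p\<in>(\<lambda>i. (i, 0)) ` {1..b}. Poly_Mapping.single (T p) (1::nat))"
    unfolding cells_hook by (intro sum.union_disjoint) auto
  also have "(\<Sum>p\<in>(\<lambda>i. (i, 0)) ` {1..b}. Poly_Mapping.single (T p) (1::nat))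
      = (\<Sum>j\<in>?J. Poly_Mapping.single j 1)"
  proof -
    have "(\<Sum>p\<in>(\<lambda>i. (i, 0)) ` {1..b}. Poly_Mapping.single (T p) (1::nat))
        = (\<Sum>i = 1..b. Poly_Mapping.single (T (i, 0)) 1)"
      by (subst sum.reindex) (simp_all add: inj_on_def comp_def)
    then show ?thesis by (simp add: sum.reindex[OF inj, unfolded comp_def] del: One_nat_def)
  qed
  also have "(\<Sum>p\<in>Pair 0 ` {..k}. Poly_Mapping.single (T p) (1::nat))
      = (\<Sum>j\<le>k. Poly_Mapping.single (T (0, j)) 1)"
    by (subst sum.reindex) (simp_all add: inj_on_def comp_def)
  also have "\<dots> = Poly_Mapping.single (T (0, 0)) 1 + (\<Sum>j = 1..k. Poly_Mapping.single (T (0, j)) 1)"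
    by (simp add: atMost_atLeast0 sum.atLeast_Suc_atMost)
  also have "(\<Sum>j = 1..k. Poly_Mapping.single (T (0, j)) 1) = weight ?arm"
    by (simp add: weight_def comp_def sum_list_distinct_conv_sum_set atLeastLessThanSuc_atLeastAtMost
        del: upt_Suc)
  also have "Poly_Mapping.single (T (0, 0)) 1 + weight ?arm + (\<Sum>j\<in>?J. Poly_Mapping.single j 1)
      = hook_deg (tableau_hook k b T)"
  proof -
    have "T (0, 0) \<notin> ?J" using J by auto
    then show ?thesis
      by (simp add: hook_deg_def tableau_hook_def mdeg_def ac_simps del: upt_Suc One_nat_def)
  qed
  finally show "(\<Sum>p\<in>?cells. Poly_Mapping.single (T p) 1) = hook_deg (tableau_hook k b T)" .
qed

lemma schur_poly_hook:
  "schur_poly n (Suc k # replicate b 1) = (\<Sum>h\<in>hooks n k b. monom (hook_deg h))"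
  unfolding schur_poly_def
proof (rule sum.reindex_bij_witness[where i = "hook_tableau n k b" and j = "tableau_hook k b"])
  fix T assume T: "T \<in> ssyt n (Suc k # replicate b 1)"
  show "hook_tableau n k b (tableau_hook k b T) = T" "tableau_hook k b T \<in> hooks n k b"
    by (rule ssyt_hook[OF T])+
  show "monom (hook_deg (tableau_hook k b T))
      = monom (\<Sum>p\<in>cells (Suc k # replicate b 1). Poly_Mapping.single (T p) 1)"
    by (simp only: ssyt_hook(3)[OF T])
next
  fix h assume h: "h \<in> hooks n k b"
  obtain c J \<gamma> where "h = (c, J, \<gamma>)" by (cases h)
  with h show "tableau_hook k b (hook_tableau n k b h) = h"
    "hook_tableau n k b h \<in> ssyt n (Suc k # replicate b 1)"
    using hook_tableau_ssyt by blast+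
qed

section \<open>The alternating sum\<close>

text \<open>The sum is the expansion of \<open>(1 - 1)\<^bsup>|S|\<^esup>\<close>.\<close>

lemma sum_Pow_alternating:
  assumes "finite S"
  shows "(\<Sum>J\<in>Pow S. (-1) ^ card J) = (if S = {} then 1 else 0 :: 'a::comm_ring_1)"
proof -
  have "(\<Sum>J\<in>Pow S. (-1) ^ card J) = (0 :: 'a) ^ card S"
    using prod_diff_conv_sum[OF assms, of "\<lambda>_. 1" "\<lambda>_. 1 :: 'a"] by simp
  then show ?thesis using assms by (simp add: power_0_left)
qed

text \<open>Group the terms by multidegree \<open>\<mu>\<close>. As \<open>c\<close> is the least variable in \<open>\<mu>\<close>, a triple is determined by \<open>\<mu>\<close>
  and \<open>J\<close>, and \<open>J\<close> can be any subset of the remaining variables. Hence only the \<open>\<mu>\<close> with a single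
  variable survive.\<close>

lemma alternating_sum_hooks:
  assumes "m \<ge> 1"
  shows "(\<Sum>b = 0..m - 1. (-1) ^ b * (\<Sum>h\<in>hooks n (m - 1 - b) b. monom (hook_deg h)))
    = (\<Sum>i = 1..n. monom (Poly_Mapping.single i m))"
proof -
  define low where "low \<mu> = Min (Poly_Mapping.keys \<mu>)" for \<mu> :: monomial
  define rest where "rest \<mu> = Poly_Mapping.keys \<mu> - {low \<mu>}" for \<mu> :: monomial
  have low: "low \<mu> \<in> Poly_Mapping.keys \<mu>" "\<And>j. j \<in> Poly_Mapping.keys \<mu> \<Longrightarrow> low \<mu> \<le> j"
    if "\<mu> \<in> exps {1..n} m" for \<mu>
  proof -
    have "Poly_Mapping.keys \<mu> \<noteq> {}" using that assms by (auto simp: exps_def)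
    then show "low \<mu> \<in> Poly_Mapping.keys \<mu>" "\<And>j. j \<in> Poly_Mapping.keys \<mu> \<Longrightarrow> low \<mu> \<le> j"
      by (simp_all add: low_def)
  qed
  have lowI: "low \<mu> = c" if "c \<in> Poly_Mapping.keys \<mu>" "\<forall>j\<in>Poly_Mapping.keys \<mu>. c \<le> j" for \<mu> c
    unfolding low_def using that by (intro Min_eqI) auto
  have "(\<Sum>b = 0..m - 1. (-1) ^ b * (\<Sum>h\<in>hooks n (m - 1 - b) b. monom (hook_deg h)))
    = (\<Sum>(b, h)\<in>(SIGMA b:{0..m - 1}. hooks n (m - 1 - b) b). (-1) ^ b * monom (hook_deg h))"
    by (simp add: sum_distrib_left sum.Sigma finite_hooks)
  also have "\<dots> = (\<Sum>(\<mu>, J)\<in>(SIGMA \<mu>:exps {1..n} m. Pow (rest \<mu>)). (-1) ^ card J * monom \<mu>)"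
  proof (rule sum.reindex_bij_witness[where
        j = "\<lambda>(b, h). (hook_deg h, fst (snd h))" and
        i = "\<lambda>(\<mu>, J). (card J, low \<mu>, J, \<mu> - mdeg (insert (low \<mu>) J) 0)"])
    fix x assume "x \<in> (SIGMA b:{0..m - 1}. hooks n (m - 1 - b) b)"
    then obtain b c J \<gamma> where x: "x = (b, c, J, \<gamma>)" "b \<le> m - 1"
      "(c, J, \<gamma>) \<in> hooks n (m - 1 - b) b" by auto
    let ?\<mu> = "mdeg (insert c J) \<gamma>"
    have *: "finite J" "c \<notin> J" "card J = b" "?\<mu> \<in> exps {1..n} m"
      "\<forall>j\<in>Poly_Mapping.keys ?\<mu>. c \<le> j"
      using x assms unfolding hooks_iff by auto
    then have keys: "insert c J \<subseteq> Poly_Mapping.keys ?\<mu>" by (simp add: keys_mdeg subset_iff)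
    then have c: "low ?\<mu> = c" using * by (intro lowI) auto
    have "?\<mu> - mdeg (insert c J) 0 = \<gamma>"
      using mdeg_complement[of "insert c J" ?\<mu>] * keys by (simp add: mdeg_eq_iff)
    then show "(case case x of (b, h) \<Rightarrow> (hook_deg h, fst (snd h)) of
        (\<mu>, J) \<Rightarrow> (card J, low \<mu>, J, \<mu> - mdeg (insert (low \<mu>) J) 0)) = x"
      using * by (simp add: x hook_deg_def c)
    show "(case x of (b, h) \<Rightarrow> (hook_deg h, fst (snd h))) \<in> (SIGMA \<mu>:exps {1..n} m. Pow (rest \<mu>))"
      using * keys by (auto simp: x hook_deg_def rest_def c)
    show "(case case x of (b, h) \<Rightarrow> (hook_deg h, fst (snd h)) of
        (\<mu>, J) \<Rightarrow> (-1) ^ card J * monom \<mu>) = (case x of (b, h) \<Rightarrow> (-1) ^ b * monom (hook_deg h))"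
      using * by (simp add: x)
  next
    fix y assume "y \<in> (SIGMA \<mu>:exps {1..n} m. Pow (rest \<mu>))"
    then obtain \<mu> J where y: "y = (\<mu>, J)" "\<mu> \<in> exps {1..n} m" "J \<subseteq> rest \<mu>" by auto
    let ?I = "insert (low \<mu>) J"
    have I: "finite J" "low \<mu> \<notin> J" "?I \<subseteq> Poly_Mapping.keys \<mu>"
      using y low(1) by (auto simp: rest_def intro: finite_subset)
    have \<mu>: "mdeg ?I (\<mu> - mdeg ?I 0) = \<mu>" using I by (intro mdeg_complement) auto
    have "m = (\<Sum>i = 1..n. Poly_Mapping.lookup (mdeg ?I (\<mu> - mdeg ?I 0)) i)"
      using y(2) unfolding \<mu> by (simp add: exps_def)
    also have "\<dots> \<ge> card ?I"
    proof -
      have "?I \<subseteq> {1..n}" using I y(2) by (auto simp: exps_def)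
      then have "card ?I = (\<Sum>i = 1..n. if i \<in> ?I then 1 else 0)"
        by (simp add: sum.If_cases Int_absorb1 del: One_nat_def insert_iff insert_subset)
      also have "\<dots> \<le> (\<Sum>i = 1..n. Poly_Mapping.lookup (mdeg ?I (\<mu> - mdeg ?I 0)) i)"
        using I by (intro sum_mono) (simp add: lookup_mdeg)
      finally show ?thesis .
    qed
    \<comment> \<open>The leg fits into the hook: each of its entries, and the corner, uses up one unit of the degree.\<close>
    finally have card: "Suc (card J) \<le> m" using I by simp
    then have "(low \<mu>, J, \<mu> - mdeg ?I 0) \<in> hooks n (m - 1 - card J) (card J)"
      unfolding hooks_iff \<mu> using I y(2) low[OF y(2)] by (auto simp: exps_def)
    then show "(case y of (\<mu>, J) \<Rightarrow> (card J, low \<mu>, J, \<mu> - mdeg (insert (low \<mu>) J) 0))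
        \<in> (SIGMA b:{0..m - 1}. hooks n (m - 1 - b) b)"
      using card by (simp add: y)
    show "(case case y of (\<mu>, J) \<Rightarrow> (card J, low \<mu>, J, \<mu> - mdeg (insert (low \<mu>) J) 0) of
        (b, h) \<Rightarrow> (hook_deg h, fst (snd h))) = y"
      by (simp add: y hook_deg_def \<mu>)
  qed
  also have "\<dots> = (\<Sum>\<mu>\<in>exps {1..n} m. (\<Sum>J\<in>Pow (rest \<mu>). (-1) ^ card J) * monom \<mu>)"
    by (simp add: sum.Sigma finite_exps rest_def sum_distrib_right del: One_nat_def)
  also have "\<dots> = (\<Sum>\<mu>\<in>exps {1..n} m. if rest \<mu> = {} then monom \<mu> else 0)"
    by (intro sum.cong) (simp_all add: sum_Pow_alternating rest_def)
  also have "\<dots> = (\<Sum>\<mu>\<in>{\<mu> \<in> exps {1..n} m. rest \<mu> = {}}. monom \<mu>)"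
    by (simp add: sum.inter_filter finite_exps)
  also have "{\<mu> \<in> exps {1..n} m. rest \<mu> = {}} = (\<lambda>i. Poly_Mapping.single i m) ` {1..n}"
  proof (intro subset_antisym subsetI)
    fix \<mu> assume "\<mu> \<in> {\<mu> \<in> exps {1..n} m. rest \<mu> = {}}"
    then have \<mu>: "\<mu> \<in> exps {1..n} m" "Poly_Mapping.keys \<mu> \<subseteq> {low \<mu>}" by (auto simp: rest_def)
    have "low \<mu> \<in> {1..n}" using low(1)[OF \<mu>(1)] \<mu>(1) by (auto simp: exps_def)
    have zero: "Poly_Mapping.lookup \<mu> i = 0" if "i \<noteq> low \<mu>" for i
      using \<mu>(2) that by (metis in_keys_iff singletonD subsetD)
    have "(\<Sum>i\<in>{low \<mu>}. Poly_Mapping.lookup \<mu> i) = (\<Sum>i = 1..n. Poly_Mapping.lookup \<mu> i)"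
      using \<open>low \<mu> \<in> {1..n}\<close> by (intro sum.mono_neutral_left) (auto simp: zero)
    then have "Poly_Mapping.lookup \<mu> (low \<mu>) = m" using \<mu>(1) by (simp add: exps_def)
    with zero have "\<mu> = Poly_Mapping.single (low \<mu>) m"
      by (intro poly_mapping_eqI) (auto simp: lookup_single when_def)
    then show "\<mu> \<in> (\<lambda>i. Poly_Mapping.single i m) ` {1..n}" using \<open>low \<mu> \<in> {1..n}\<close> by blast
  next
    fix \<mu> assume "\<mu> \<in> (\<lambda>i. Poly_Mapping.single i m) ` {1..n}"
    then obtain i where i: "i \<in> {1..n}" "\<mu> = Poly_Mapping.single i m" by blast
    have "\<mu> \<in> exps {1..n} m"
      using i assms by (simp add: exps_def lookup_single when_def)
    then show "\<mu> \<in> {\<mu> \<in> exps {1..n} m. rest \<mu> = {}}"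
      using i assms low(1)[OF \<open>\<mu> \<in> exps {1..n} m\<close>] by (simp add: rest_def)
  qed
  also have "(\<Sum>\<mu>\<in>(\<lambda>i. Poly_Mapping.single i m) ` {1..n}. monom \<mu>)
      = (\<Sum>i = 1..n. monom (Poly_Mapping.single i m))"
  proof (rule sum.reindex_cong[OF _ refl refl])
    show "inj_on (\<lambda>i. Poly_Mapping.single i m) {1..n}"
      using assms by (intro inj_onI) (metis lookup_single_eq lookup_single_not_eq not_one_le_zero)
  qed
  finally show ?thesis .
qed

theorem corollary3p26:
  fixes scale :: "'k::field \<Rightarrow> 'v::ab_group_add \<Rightarrow> 'v" and v :: "nat \<Rightarrow> 'v" and n m :: nat
  assumes "vector_space scale"
    and "inj_on v {1..n}"
    and "\<not> module.dependent scale (v ` {1..n})"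
    and "module.span scale (v ` {1..n}) = UNIV"
    and "m \<ge> 1"
  shows "ch v n (power_span scale v n m)
           = (\<Sum>i = 0..m - 1. (-1) ^ i * ch v n (hook_schur scale (m - i) i))
       \<and> ch v n (power_span scale v n m) = (\<Sum>i = 1..n. monom (Poly_Mapping.single i m))
       \<and> (\<forall>i\<in>{0..m - 1}.
            ch v n (hook_schur scale (m - i) i) = schur_poly n ((m - i) # replicate i 1))"
proof -
  interpret based_space scale v n
    using assms by (intro based_space.intro based_space_axioms.intro)
  have hook: "ch v n (hook_schur scale (m - i) i) = (\<Sum>h\<in>hooks n (m - 1 - i) i. monom (hook_deg h))"
    and schur: "schur_poly n ((m - i) # replicate i 1) = (\<Sum>h\<in>hooks n (m - 1 - i) i. monom (hook_deg h))"
    if "i \<in> {0..m - 1}" for i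
  proof -
    have "m - i = Suc (m - 1 - i)" using that assms(5) by auto
    then show "ch v n (hook_schur scale (m - i) i) = (\<Sum>h\<in>hooks n (m - 1 - i) i. monom (hook_deg h))"
      and "schur_poly n ((m - i) # replicate i 1) = (\<Sum>h\<in>hooks n (m - 1 - i) i. monom (hook_deg h))"
      using ch_hook_schur schur_poly_hook by metis+
  qed
  have power: "ch v n (power_span scale v n m) = (\<Sum>i = 1..n. monom (Poly_Mapping.single i m))"
    using assms(5) by (rule ch_power_span)
  have "(\<Sum>i = 0..m - 1. (-1) ^ i * ch v n (hook_schur scale (m - i) i))
      = (\<Sum>i = 0..m - 1. (-1) ^ i * (\<Sum>h\<in>hooks n (m - 1 - i) i. monom (hook_deg h)))"
    by (intro sum.cong) (simp_all add: hook)
  also have "\<dots> = (\<Sum>i = 1..n. monom (Poly_Mapping.single i m))"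
    using assms(5) by (rule alternating_sum_hooks)
  finally show ?thesis using power hook schur by simp
qed

end
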